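(* For all integers $p,q\ge2$, the labelled Diestel–Leader graph $\mathrm{DL}(p,q)$ has undecidable seeded tiling problem: there is no algorithm which, given a finite set $C$, a subset $\Pi\subseteq C\times(\{0,\dots,p-1\}\times\{0,\dots,q-1\})\times C$ and $c_0\in C$, decides whether there is a colouring $\kappa\colon V(\mathrm{DL}(p,q))\to C$ with $\kappa(o)=c_0$ and $(\kappa(x),\ell(e),\kappa(y))\in\Pi$ for every edge $e$ of $\mathrm{DL}(p,q)$, where $x$ is the endpoint of $e$ with smaller marker position, $y$ the one with larger marker position, and $\ell(e)$ the label of $e$.
   Context: **Vertices.** A vertex of $\mathrm{DL}(p,q)$ is a pair $(n,x)$, where $n\in\mathbb Z$ is the marker position and $x\colon\mathbb Z+\tfrac12\to\mathbb N$ is finitely supported. It is required that $x(i)\in\{0,\dots,q-1\}$ for $i<n$ and $x(i)\in\{0,\dots,p-1\}$ for $i>n$. **Edges.** Two vertices $(n,x)$ and $(n+1,y)$ are joined by an edge if and only if $x$ and $y$ agree at every position except possibly $n+\tfrac12$. Such an edge has label $(x(n+\tfrac12),y(n+\tfrac12))\in\{0,\dots,p-1\}\times\{0,\dots,q-1\}$. There are no other edges. **Seed.** The seed vertex $o$ is the vertex with marker $0$ and $x\equiv0$. (Equivalently, $\mathrm{DL}(p,q)$ is the horocyclic product of a $(p+1)$-regular and a $(q+1)$-regular tree, with this natural edge labelling.) *)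

theory Defs
  imports Main "HOL-Library.Nat_Bijection"
begin

section \<open>Algorithms: partial recursive functions\<close>

datatype recf =
    Zero
  | Succ
  | Proj nat
  | Comp recf "recf list"
  | PrimRec recf recf
  | Mu recf

text \<open>
  \<open>computes f xs y\<close> states that the partial recursive function described by \<open>f\<close> is defined on
  the argument list \<open>xs\<close>, with value \<open>y\<close>. Descriptions carry no arity; one that is applied to
  an unsuitable number of arguments is simply undefined there.
  The recursion variable of \<open>PrimRec\<close> and the search variable of \<open>Mu\<close> come first in the
  argument list.
\<close>

inductive computes :: "recf \<Rightarrow> nat list \<Rightarrow> nat \<Rightarrow> bool" where
  Zero: "computes Zero xs 0"
| Succ: "computes Succ [x] (Suc x)"
| Proj: "i < length xs \<Longrightarrow> computes (Proj i) xs (xs ! i)"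
| Comp: "list_all2 (\<lambda>g y. computes g xs y) gs ys \<Longrightarrow> computes f ys z
    \<Longrightarrow> computes (Comp f gs) xs z"
| PrimRec_0: "computes f xs y \<Longrightarrow> computes (PrimRec f g) (0 # xs) y"
| PrimRec_Suc: "computes (PrimRec f g) (n # xs) r \<Longrightarrow> computes g (n # r # xs) y
    \<Longrightarrow> computes (PrimRec f g) (Suc n # xs) y"
| Mu: "computes f (n # xs) 0 \<Longrightarrow> (\<forall>m<n. \<exists>y. computes f (m # xs) (Suc y))
    \<Longrightarrow> computes (Mu f) xs n"

inductive_cases computes_ZeroE: "computes Zero xs y"
inductive_cases computes_SuccE: "computes Succ xs y"
inductive_cases computes_ProjE: "computes (Proj i) xs y"
inductive_cases computes_CompE: "computes (Comp f gs) xs y"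
inductive_cases computes_PrimRec_0E: "computes (PrimRec f g) (0 # xs) y"
inductive_cases computes_PrimRec_SucE: "computes (PrimRec f g) (Suc n # xs) y"
inductive_cases computes_MuE: "computes (Mu f) xs y"

lemma computes_deterministic:
  "computes f xs y \<Longrightarrow> computes f xs y' \<Longrightarrow> y = y'"
proof (induction arbitrary: y' rule: computes.induct)
  case (Zero xs)
  then show ?case by (blast elim: computes_ZeroE)
next
  case (Succ x)
  then show ?case by (blast elim: computes_SuccE)
next
  case (Proj i xs)
  then show ?case by (blast elim: computes_ProjE)
next
  case (Comp xs gs ys f z)
  from Comp.prems obtain ys' where
    ys': "list_all2 (\<lambda>g y. computes g xs y) gs ys'" "computes f ys' y'"
    by (rule computes_CompE)
  have "ys = ys'"
    using Comp.IH(1) ys'(1) by (simp add: list_all2_conv_all_nth list_eq_iff_nth_eq)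
  then show ?case using Comp.IH(2) ys'(2) by blast
next
  case (PrimRec_0 f xs y g)
  then show ?case by (blast elim: computes_PrimRec_0E)
next
  case (PrimRec_Suc f g n xs r y)
  from PrimRec_Suc.prems obtain r' where
    "computes (PrimRec f g) (n # xs) r'" "computes g (n # r' # xs) y'"
    by (rule computes_PrimRec_SucE)
  then show ?case using PrimRec_Suc.IH by blast
next
  case (Mu f n xs)
  from Mu.prems have
    *: "computes f (y' # xs) 0" "\<forall>m<y'. \<exists>y. computes f (m # xs) (Suc y)"
    by (blast elim: computes_MuE)+
  show ?case
  proof (rule linorder_cases[of n y'])
    assume "n < y'"
    with *(2) Mu.IH(1) show ?thesis by blast
  next
    assume "y' < n"
    with *(1) Mu.IH(2) show ?thesis by blast
  qed
qed


section \<open>The labelled Diestel--Leader graph\<close>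

text \<open>
  The half-integer position \<open>i + 1/2\<close> is represented by the integer \<open>i\<close>. Hence a position
  lies below the marker \<open>n\<close> iff \<open>i < n\<close> and above it iff \<open>n \<le> i\<close>, and the position
  \<open>n + 1/2\<close> crossed by an edge from marker \<open>n\<close> to marker \<open>n + 1\<close> is represented by \<open>n\<close>.
\<close>

type_synonym vertex = "int \<times> (int \<Rightarrow> nat)"

definition DL_verts :: "nat \<Rightarrow> nat \<Rightarrow> vertex set" where
  "DL_verts p q = {(n, x). finite {i. x i \<noteq> 0} \<and> (\<forall>i<n. x i < q) \<and> (\<forall>i\<ge>n. x i < p)}"

text \<open>Each edge is listed once, as the pair (lower endpoint, upper endpoint).\<close>

definition DL_edges :: "nat \<Rightarrow> nat \<Rightarrow> (vertex \<times> vertex) set" where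
  "DL_edges p q = {((n, x), (m, y)).
     (n, x) \<in> DL_verts p q \<and> (m, y) \<in> DL_verts p q \<and> m = n + 1 \<and> (\<forall>i. i \<noteq> n \<longrightarrow> x i = y i)}"

fun DL_label :: "vertex \<times> vertex \<Rightarrow> nat \<times> nat" where
  "DL_label ((n, x), (m, y)) = (x n, y n)"

definition DL_seed :: vertex where
  "DL_seed = (0, \<lambda>_. 0)"


section \<open>The seeded tiling problem\<close>

type_synonym 'c rule = "'c \<times> (nat \<times> nat) \<times> 'c"

definition tiling_instance :: "nat \<Rightarrow> nat \<Rightarrow> 'c set \<Rightarrow> 'c rule set \<Rightarrow> 'c \<Rightarrow> bool" where
  "tiling_instance p q C R c0 \<longleftrightarrow>
     finite C \<and> R \<subseteq> C \<times> ({0..<p} \<times> {0..<q}) \<times> C \<and> c0 \<in> C"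

definition has_seeded_tiling :: "nat \<Rightarrow> nat \<Rightarrow> 'c set \<Rightarrow> 'c rule set \<Rightarrow> 'c \<Rightarrow> bool" where
  "has_seeded_tiling p q C R c0 \<longleftrightarrow>
     (\<exists>\<kappa>. (\<forall>v\<in>DL_verts p q. \<kappa> v \<in> C) \<and> \<kappa> DL_seed = c0 \<and>
        (\<forall>(u, v)\<in>DL_edges p q. (\<kappa> u, DL_label (u, v), \<kappa> v) \<in> R))"

text \<open>
  As input to an algorithm, colours are natural numbers, and the finite sets of colours and of
  rules are given by their canonical indices \<^const>\<open>set_encode\<close> (the number whose binary
  digits form the characteristic function of the set).
\<close>

fun rule_encode :: "nat rule \<Rightarrow> nat" where
  "rule_encode (a, (i, j), b) = prod_encode (a, prod_encode (prod_encode (i, j), b))"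

definition decides_seeded_tiling :: "recf \<Rightarrow> nat \<Rightarrow> nat \<Rightarrow> bool" where
  "decides_seeded_tiling f p q \<longleftrightarrow>
     (\<forall>C R c0. tiling_instance p q C R c0 \<longrightarrow>
        computes f [set_encode C, set_encode (rule_encode ` R), c0]
          (if has_seeded_tiling p q C R c0 then 1 else 0))"

end

theory Submission
  imports Defs
begin

text \<open>
  Write \<open>e\<^sub>k\<close> for the word with a single 1 at \<open>k\<close>. The row vertices \<open>(k, e\<^sub>n)\<close> and the column
  vertices \<open>(n + 1, e\<^sub>k)\<close>, for \<open>k \<le> n\<close>, form the rows and columns of an octant of the integer
  grid: following the marker along a row changes \<open>k\<close>, along a column it changes \<open>n\<close>, and the
  paths \<open>(m, e\<^sub>k + e\<^sub>n)\<close>, \<open>k < m \<le> n\<close>, which join \<open>(k, e\<^sub>n)\<close> to \<open>(n + 1, e\<^sub>k)\<close>, are pairwise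
  disjoint. Local rules can make such a path carry one letter, so seeded tilings of the octant
  are simulated; the vertices not needed for this receive a neutral colour. The vertices
  with zero word count down from the seed, which bounds the phase in which a counter
  machine loads its input; afterwards the row \<open>n\<close> of the octant describes step \<open>n\<close> of the machine,
  a halted machine having no letter.

  Counter machines compute all partial recursive functions. Given a decision procedure, let a
  machine apply it to the instance obtained from its input \<open>N\<close>, read as the code of a set of rules,
  by adding the rules for a countdown from \<open>N\<close>, and halt iff the answer is that a tiling exists.
  Run on the code of its own rules, it halts iff it does not.
\<close>

section \<open>Counter programs\<close>

definition mstep :: "('s \<Rightarrow> nat set) \<Rightarrow> ('s \<Rightarrow> nat set) \<Rightarrow> ('s \<Rightarrow> nat set \<Rightarrow> 's)
    \<Rightarrow> 's \<times> (nat \<Rightarrow> nat) \<Rightarrow> 's \<times> (nat \<Rightarrow> nat)" where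
  "mstep up dn nxt = (\<lambda>(s, f). (nxt s {i. 0 < f i},
     \<lambda>i. if i \<in> up s then Suc (f i) else if i \<in> dn s then f i - 1 else f i))"

datatype com = Inc nat | Dec nat | Seq com com | While nat com

fun inc_regs :: "com list \<Rightarrow> nat set" where
  "inc_regs (Inc r # K) = {r}"
| "inc_regs _ = {}"

fun dec_regs :: "com list \<Rightarrow> nat set" where
  "dec_regs (Dec r # K) = {r}"
| "dec_regs _ = {}"

fun next_cont :: "com list \<Rightarrow> nat set \<Rightarrow> com list" where
  "next_cont [] A = []"
| "next_cont (Inc r # K) A = K"
| "next_cont (Dec r # K) A = K"
| "next_cont (Seq c d # K) A = c # d # K"
| "next_cont (While r c # K) A = (if r \<in> A then c # While r c # K else K)"

definition cstep :: "com list \<times> (nat \<Rightarrow> nat) \<Rightarrow> com list \<times> (nat \<Rightarrow> nat)" where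
  "cstep = mstep inc_regs dec_regs next_cont"

lemma cstep_simps [simp]:
  "cstep ([], s) = ([], s)"
  "cstep (Inc r # K, s) = (K, s(r := Suc (s r)))"
  "cstep (Dec r # K, s) = (K, s(r := s r - 1))"
  "cstep (Seq c d # K, s) = (c # d # K, s)"
  "cstep (While r c # K, s) = (if s r = 0 then K else c # While r c # K, s)"
  by (auto simp: cstep_def mstep_def)

section \<open>The finitely many continuations of a program\<close>

fun conts :: "com \<Rightarrow> com list \<Rightarrow> com list set" where
  "conts (Inc r) K = {Inc r # K, K}"
| "conts (Dec r) K = {Dec r # K, K}"
| "conts (Seq c d) K = insert (Seq c d # K) (conts c (d # K) \<union> conts d K)"
| "conts (While r c) K = insert (While r c # K) (insert K (conts c (While r c # K)))"

lemma finite_conts: "finite (conts c K)"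
  by (induction c K rule: conts.induct) auto

lemma conts_start: "c # K \<in> conts c K"
  by (cases c) auto

text \<open>A command leaves its continuations only at \<open>K\<close>. For \<open>K = []\<close>,
  a fixed point of \<open>next_cont\<close>, the finite set \<open>conts c []\<close> can therefore
  serve as the state set of a machine.\<close>

lemma conts_closed: "L \<in> conts c K \<Longrightarrow> L = K \<or> next_cont L A \<in> conts c K"
proof (induction c K rule: conts.induct)
  case (3 c d K)
  then show ?case using conts_start[of c "d # K"] conts_start[of d K] by auto
next
  case (4 r c K)
  then show ?case using conts_start[of c "While r c # K"] by auto
qed auto

text \<open>The quantifier over \<open>K\<close> makes executions compose: a command must act in the
  same way in front of any rest of the program.\<close>

definition exec :: "com \<Rightarrow> (nat \<Rightarrow> nat) \<Rightarrow> (nat \<Rightarrow> nat) \<Rightarrow> bool" where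
  "exec c s t \<longleftrightarrow> (\<forall>K. \<exists>n. (cstep ^^ n) (c # K, s) = (K, t))"

lemma exec_Inc: "exec (Inc r) s (s(r := Suc (s r)))"
  unfolding exec_def by (intro allI exI[of _ 1]) simp

lemma exec_Dec: "exec (Dec r) s (s(r := s r - 1))"
  unfolding exec_def by (intro allI exI[of _ 1]) simp

lemma exec_Seq:
  assumes "exec c s t" "exec d t u"
  shows "exec (Seq c d) s u"
  unfolding exec_def
proof
  fix K
  obtain n where n: "(cstep ^^ n) (c # d # K, s) = (d # K, t)"
    using assms(1) unfolding exec_def by blast
  obtain m where m: "(cstep ^^ m) (d # K, t) = (K, u)"
    using assms(2) unfolding exec_def by blast
  have "(cstep ^^ (m + (n + 1))) (Seq c d # K, s) = (K, u)"
    by (simp only: funpow_add) (simp add: n m)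
  then show "\<exists>n. (cstep ^^ n) (Seq c d # K, s) = (K, u)" by blast
qed

lemma exec_While_0: "s r = 0 \<Longrightarrow> exec (While r c) s s"
  unfolding exec_def by (intro allI exI[of _ 1]) simp

lemma exec_While_step:
  assumes "s r \<noteq> 0" "exec c s t" "exec (While r c) t u"
  shows "exec (While r c) s u"
  unfolding exec_def
proof
  fix K
  obtain n where n: "(cstep ^^ n) (c # While r c # K, s) = (While r c # K, t)"
    using assms(2) unfolding exec_def by blast
  obtain m where m: "(cstep ^^ m) (While r c # K, t) = (K, u)"
    using assms(3) unfolding exec_def by blast
  have "(cstep ^^ (m + (n + 1))) (While r c # K, s) = (K, u)"
    by (simp only: funpow_add) (simp add: n m assms(1))
  then show "\<exists>n. (cstep ^^ n) (While r c # K, s) = (K, u)" by blast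
qed

text \<open>An explicit sequence of stores takes the place of a loop invariant:
  \<open>\<sigma> j\<close> is the store after \<open>j\<close> rounds.\<close>

lemma exec_While:
  assumes "\<And>j. j < n \<Longrightarrow> \<sigma> j r \<noteq> 0" "\<And>j. j < n \<Longrightarrow> exec c (\<sigma> j) (\<sigma> (Suc j))"
    and "\<sigma> n r = 0" "s = \<sigma> 0" "t = \<sigma> n"
  shows "exec (While r c) s t"
  using assms
proof (induction n arbitrary: \<sigma> s t)
  case 0
  then show ?case by (simp add: exec_While_0)
next
  case (Suc n)
  have "exec (While r c) (\<sigma> 1) (\<sigma> (Suc n))"
    by (rule Suc.IH[of "\<lambda>j. \<sigma> (Suc j)"]) (use Suc.prems in auto)
  moreover have "exec c (\<sigma> 0) (\<sigma> 1)" using Suc.prems(2)[of 0] by simp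
  ultimately show ?case using exec_While_step[of "\<sigma> 0" r c] Suc.prems by blast
qed

lemma exec_eq: "exec c s t \<Longrightarrow> t = t' \<Longrightarrow> exec c s t'"
  by simp

section \<open>Clearing, moving and copying registers\<close>

definition clear :: "nat \<Rightarrow> com" where
  "clear r = While r (Dec r)"

lemma exec_clear: "exec (clear r) s (s(r := 0))"
  unfolding clear_def
  by (rule exec_While[where n = "s r" and \<sigma> = "\<lambda>j. s(r := s r - j)"])
     (auto intro!: exec_eq[OF exec_Dec])

definition move :: "nat \<Rightarrow> nat \<Rightarrow> com" where
  "move a b = While a (Seq (Dec a) (Inc b))"

lemma exec_move: "a \<noteq> b \<Longrightarrow> exec (move a b) s (s(a := 0, b := s b + s a))"
  unfolding move_def
  by (rule exec_While[where n = "s a" and \<sigma> = "\<lambda>j. s(a := s a - j, b := s b + j)"])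
     (auto intro!: exec_Seq[OF exec_Dec exec_eq[OF exec_Inc]] simp: fun_eq_iff)

text \<open>A register is read by counting it down; \<open>t\<close> keeps a second copy from which
  \<open>a\<close> is restored. The value is added to \<open>b\<close>, so \<open>b\<close> receives
  a copy if it holds 0.\<close>

definition copy :: "nat \<Rightarrow> nat \<Rightarrow> nat \<Rightarrow> com" where
  "copy a b t = Seq (While a (Seq (Dec a) (Seq (Inc b) (Inc t)))) (move t a)"

lemma exec_copy:
  assumes "a \<noteq> b" "a \<noteq> t" "b \<noteq> t" "s t = 0"
  shows "exec (copy a b t) s (s(b := s b + s a))"
proof -
  have "exec (While a (Seq (Dec a) (Seq (Inc b) (Inc t)))) s (s(a := 0, b := s b + s a, t := s a))"
    by (rule exec_While[where n = "s a" and \<sigma> = "\<lambda>j. s(a := s a - j, b := s b + j, t := j)"])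
       (use assms in \<open>auto intro!: exec_Seq[OF exec_Dec exec_Seq[OF exec_Inc exec_eq[OF exec_Inc]]]
          simp: fun_eq_iff\<close>)
  then show ?thesis unfolding copy_def
    by (rule exec_Seq[OF _ exec_eq[OF exec_move]]) (use assms in \<open>auto simp: fun_eq_iff\<close>)
qed

text \<open>There is no empty command; clearing a register that is already 0 replaces it.\<close>

definition clears :: "nat \<Rightarrow> nat list \<Rightarrow> com" where
  "clears k rs = foldr (\<lambda>r c. Seq (clear r) c) rs (clear k)"

lemma exec_clears: "exec (clears k rs) s (\<lambda>i. if i \<in> insert k (set rs) then 0 else s i)"
proof (induction rs arbitrary: s)
  case Nil
  then show ?case unfolding clears_def by (auto intro!: exec_eq[OF exec_clear])
next
  case (Cons r rs)
  have "exec (Seq (clear r) (clears k rs)) s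
      (\<lambda>i. if i \<in> insert k (set rs) then 0 else (s(r := 0)) i)"
    by (rule exec_Seq[OF exec_clear Cons.IH])
  then show ?case unfolding clears_def by (auto elim!: exec_eq)
qed

section \<open>Compilation of partial recursive functions\<close>

fun eval_args :: "(nat list \<Rightarrow> nat \<Rightarrow> nat \<Rightarrow> com) list \<Rightarrow> nat list \<Rightarrow> nat \<Rightarrow> nat \<Rightarrow> com" where
  "eval_args [] js r k = clear k"
| "eval_args (c # cs) js r k = Seq (c js r k) (eval_args cs js (Suc r) k)"

text \<open>The arguments are in the registers \<open>js\<close>, the result goes to
  \<open>r\<close>, and the registers from \<open>k\<close> on are scratch space. In primitive
  recursion \<open>k\<close> counts the remaining rounds, \<open>k + 1\<close> holds the current
  value, \<open>k + 2\<close> the recursion index and \<open>k + 3\<close> the next value; in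
  minimisation \<open>k\<close> is the candidate and \<open>k + 1\<close> the value of
  \<open>f\<close> there.\<close>

primrec compile :: "recf \<Rightarrow> nat list \<Rightarrow> nat \<Rightarrow> nat \<Rightarrow> com" where
  "compile Zero = (\<lambda>js r k. clear r)"
| "compile Succ = (\<lambda>js r k. Seq (copy (hd js) r k) (Inc r))"
| "compile (Proj i) = (\<lambda>js r k. copy (js ! i) r k)"
| "compile (Comp f gs) = (\<lambda>js r k.
     Seq (eval_args (map compile gs) js k (k + length gs))
    (Seq (compile f [k..<k + length gs] r (k + length gs))
         (clears (k + length gs) [k..<k + length gs])))"
| "compile (PrimRec f g) = (\<lambda>js r k.
     Seq (copy (hd js) k (k + 4))
    (Seq (compile f (tl js) (k + 1) (k + 4))
    (Seq (While k
           (Seq (Dec k)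
           (Seq (compile g ((k + 2) # (k + 1) # tl js) (k + 3) (k + 4))
           (Seq (clear (k + 1))
           (Seq (move (k + 3) (k + 1))
                (Inc (k + 2)))))))
    (Seq (move (k + 1) r)
         (clear (k + 2))))))"
| "compile (Mu f) = (\<lambda>js r k.
     Seq (compile f (k # js) (k + 1) (k + 2))
    (Seq (While (k + 1)
           (Seq (clear (k + 1))
           (Seq (Inc k)
                (compile f (k # js) (k + 1) (k + 2)))))
         (move k r)))"

text \<open>Nothing is claimed where \<open>f\<close> is undefined. Moving and copying add to their
  target, so \<open>r\<close> and the scratch registers must start at 0; the final store differs
  only at \<open>r\<close>, so the scratch space is clean again and can be reused.\<close>

definition implements :: "(nat list \<Rightarrow> nat \<Rightarrow> nat \<Rightarrow> com) \<Rightarrow> recf \<Rightarrow> bool" where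
  "implements c f \<longleftrightarrow> (\<forall>js r k s y. computes f (map s js) y \<longrightarrow> (\<forall>j\<in>set js. j < k) \<longrightarrow> r < k \<longrightarrow>
     r \<notin> set js \<longrightarrow> s r = 0 \<longrightarrow> (\<forall>i\<ge>k. s i = 0) \<longrightarrow> exec (c js r k) s (s(r := y)))"

lemma implementsD:
  assumes "implements c f" "computes f xs y" "map s js = xs" "\<And>j. j \<in> set js \<Longrightarrow> j < k" "r < k"
    "r \<notin> set js" "s r = 0" "\<And>i. k \<le> i \<Longrightarrow> s i = 0"
  shows "exec (c js r k) s (s(r := y))"
  using assms unfolding implements_def by blast

lemma exec_eval_args:
  assumes "list_all2 (\<lambda>g y. computes g xs y) gs ys"
    and "\<And>g. g \<in> set gs \<Longrightarrow> implements (compile g) g"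
    and "map s js = xs" "\<And>j. j \<in> set js \<Longrightarrow> j < r" "k = r + length gs"
    and "\<And>i. r \<le> i \<Longrightarrow> s i = 0"
  shows "exec (eval_args (map compile gs) js r k) s
    (\<lambda>i. if r \<le> i \<and> i < k then ys ! (i - r) else s i)"
  using assms
proof (induction gs arbitrary: ys r s)
  case Nil
  then show ?case by (auto intro!: exec_eq[OF exec_clear])
next
  case (Cons g gs)
  obtain y ys' where ys: "ys = y # ys'" "computes g xs y"
      "list_all2 (\<lambda>g y. computes g xs y) gs ys'"
    using Cons.prems(1) by (auto simp: list_all2_Cons1)
  have 1: "exec (compile g js r k) s (s(r := y))"
    by (rule implementsD[OF Cons.prems(2) ys(2) Cons.prems(3)])
       (use Cons.prems(4-6) in \<open>force+\<close>)
  have "map (s(r := y)) js = xs"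
    using Cons.prems(3,4) by force
  then have 2: "exec (eval_args (map compile gs) js (Suc r) k) (s(r := y))
    (\<lambda>i. if Suc r \<le> i \<and> i < k then ys' ! (i - Suc r) else (s(r := y)) i)"
    by (intro Cons.IH ys) (use Cons.prems(2,4-6) in \<open>auto simp: less_SucI\<close>)
  show ?case
    by (simp, rule exec_Seq[OF 1 exec_eq[OF 2]])
       (use Cons.prems(5) in \<open>auto simp: fun_eq_iff ys nth_Cons' Suc_le_eq\<close>)
qed

lemma implements_Comp:
  assumes f: "implements (compile f) f" and gs: "\<And>g. g \<in> set gs \<Longrightarrow> implements (compile g) g"
  shows "implements (compile (Comp f gs)) (Comp f gs)"
  unfolding implements_def
proof (intro allI impI)
  fix js :: "nat list" and r k z :: nat and s :: "nat \<Rightarrow> nat"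
  assume c: "computes (Comp f gs) (map s js) z" and js: "\<forall>j\<in>set js. j < k" and "r < k"
    "r \<notin> set js" "s r = 0" and s: "\<forall>i\<ge>k. s i = 0"
  obtain ys where ys: "list_all2 (\<lambda>g y. computes g (map s js) y) gs ys" "computes f ys z"
    using c by (rule computes_CompE)
  let ?b = "k + length gs"
  let ?t = "\<lambda>i. if k \<le> i \<and> i < ?b then ys ! (i - k) else s i"
  have len: "length ys = length gs" using ys(1) by (simp add: list_all2_lengthD)
  have 1: "exec (eval_args (map compile gs) js k ?b) s ?t"
    by (rule exec_eval_args[OF ys(1) gs]) (use js s in auto)
  have "map ?t [k..<?b] = ys"
    by (rule nth_equalityI) (auto simp: len)
  then have 2: "exec (compile f [k..<?b] r ?b) ?t (?t(r := z))"
    by (intro implementsD[OF f ys(2)]) (use \<open>r < k\<close> \<open>s r = 0\<close> s in auto)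
  show "exec (compile (Comp f gs) js r k) s (s(r := z))"
    by (simp, rule exec_Seq[OF 1 exec_Seq[OF 2 exec_eq[OF exec_clears]]])
       (use \<open>r < k\<close> s in \<open>auto simp: fun_eq_iff\<close>)
qed

text \<open>Unrolling the derivation yields the successive values of the recursion, from which the
  stores between the rounds of the compiled loop are defined.\<close>

lemma computes_PrimRec_trace:
  assumes "computes (PrimRec f g) (n # xs) y"
  shows "\<exists>v. computes f xs (v 0) \<and> (\<forall>m<n. computes g (m # v m # xs) (v (Suc m))) \<and> v n = y"
  using assms
proof (induction n arbitrary: y)
  case 0
  then have "computes f xs y" by (rule computes_PrimRec_0E)
  then show ?case by (intro exI[of _ "\<lambda>_. y"]) simp
next
  case (Suc n)
  obtain v' where 1: "computes (PrimRec f g) (n # xs) v'" "computes g (n # v' # xs) y"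
    using Suc.prems by (rule computes_PrimRec_SucE)
  obtain v where v: "computes f xs (v 0)" "\<forall>m<n. computes g (m # v m # xs) (v (Suc m))" "v n = v'"
    using Suc.IH[OF 1(1)] by blast
  show ?case
    by (rule exI[of _ "v(Suc n := y)"]) (use v 1 in \<open>auto simp: less_Suc_eq\<close>)
qed

lemma implements_PrimRec:
  assumes f: "implements (compile f) f" and g: "implements (compile g) g"
  shows "implements (compile (PrimRec f g)) (PrimRec f g)"
  unfolding implements_def
proof (intro allI impI)
  fix js :: "nat list" and r k y :: nat and s :: "nat \<Rightarrow> nat"
  assume c: "computes (PrimRec f g) (map s js) y" and js: "\<forall>j\<in>set js. j < k" and "r < k"
    "r \<notin> set js" "s r = 0" and s: "\<forall>i\<ge>k. s i = 0"
  obtain a us where js': "js = a # us"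
    using c by (cases js) (auto elim: computes.cases)
  obtain v where v: "computes f (map s us) (v 0)"
      "\<And>m. m < s a \<Longrightarrow> computes g (m # v m # map s us) (v (Suc m))" "v (s a) = y"
    using computes_PrimRec_trace[of f g "s a" "map s us" y] c js' by auto
  have sz: "s (k + i) = 0" "s k = 0" "s (Suc k) = 0" "s (Suc (Suc k)) = 0" for i
    using s by auto
  have a: "a < k" "a \<noteq> r" and us: "\<And>j. j \<in> set us \<Longrightarrow> j < k" "r \<notin> set us"
    using js \<open>r \<notin> set js\<close> js' by auto
  have m: "map (s(k := x1, k + 1 := x2, k + 2 := x3)) us = map s us" for x1 x2 x3
    using us(1) by force
  let ?\<sigma> = "\<lambda>j. s(k := s a - j, k + 1 := v j, k + 2 := j)"
  have 1: "exec (copy a k (k + 4)) s (s(k := s a))"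
    by (rule exec_eq[OF exec_copy]) (use a sz in auto)
  have 2: "exec (compile f us (k + 1) (k + 4)) (s(k := s a)) (?\<sigma> 0)"
    by (rule exec_eq[OF implementsD[OF f v(1)]])
       (use us m[of "s a" 0 0] s sz in \<open>force simp: fun_eq_iff\<close>)+
  have 3: "exec (Seq (Dec k)
           (Seq (compile g ((k + 2) # (k + 1) # us) (k + 3) (k + 4))
           (Seq (clear (k + 1))
           (Seq (move (k + 3) (k + 1))
                (Inc (k + 2)))))) (?\<sigma> j) (?\<sigma> (Suc j))" if "j < s a" for j
  proof -
    let ?u = "s(k := s a - Suc j, k + 1 := v j, k + 2 := j)"
    have "exec (Dec k) (?\<sigma> j) ?u"
      by (rule exec_eq[OF exec_Dec]) (auto simp: fun_eq_iff)
    moreover have "exec (compile g ((k + 2) # (k + 1) # us) (k + 3) (k + 4)) ?u (?u(k + 3 := v (Suc j)))"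
      by (rule implementsD[OF g v(2)[OF that]]) (use us(1) m s sz in \<open>force+\<close>)
    moreover have "exec (clear (k + 1)) (?u(k + 3 := v (Suc j))) (?u(k + 3 := v (Suc j), k + 1 := 0))"
      by (rule exec_clear)
    moreover have "exec (move (k + 3) (k + 1)) (?u(k + 3 := v (Suc j), k + 1 := 0)) (?u(k + 1 := v (Suc j)))"
      by (rule exec_eq[OF exec_move]) (auto simp: fun_eq_iff sz)
    moreover have "exec (Inc (k + 2)) (?u(k + 1 := v (Suc j))) (?\<sigma> (Suc j))"
      by (rule exec_eq[OF exec_Inc]) (auto simp: fun_eq_iff)
    ultimately show ?thesis by (blast intro: exec_Seq)
  qed
  have 4: "exec (While k (Seq (Dec k)
           (Seq (compile g ((k + 2) # (k + 1) # us) (k + 3) (k + 4))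
           (Seq (clear (k + 1))
           (Seq (move (k + 3) (k + 1))
                (Inc (k + 2))))))) (?\<sigma> 0) (?\<sigma> (s a))"
    by (rule exec_While[where \<sigma> = ?\<sigma> and n = "s a"]) (use 3 in auto)
  have 5: "exec (move (k + 1) r) (?\<sigma> (s a)) (s(k + 2 := s a, r := y))"
    by (rule exec_eq[OF exec_move])
       (use \<open>r < k\<close> \<open>s r = 0\<close> sz v(3) in \<open>auto simp: fun_eq_iff\<close>)
  have 6: "exec (clear (k + 2)) (s(k + 2 := s a, r := y)) (s(r := y))"
    by (rule exec_eq[OF exec_clear]) (use \<open>r < k\<close> sz in \<open>auto simp: fun_eq_iff\<close>)
  show "exec (compile (PrimRec f g) js r k) s (s(r := y))"
    using 1 2 4 5 6 by (auto simp: js' intro!: exec_Seq)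
qed

lemma implements_Mu:
  assumes f: "implements (compile f) f"
  shows "implements (compile (Mu f)) (Mu f)"
  unfolding implements_def
proof (intro allI impI)
  fix js :: "nat list" and r k n :: nat and s :: "nat \<Rightarrow> nat"
  assume c: "computes (Mu f) (map s js) n" and js: "\<forall>j\<in>set js. j < k" and "r < k"
    "r \<notin> set js" "s r = 0" and s: "\<forall>i\<ge>k. s i = 0"
  have "computes f (n # map s js) 0" "\<forall>m<n. \<exists>y. computes f (m # map s js) (Suc y)"
    using c by (auto elim: computes_MuE)
  \<comment> \<open>Beyond \<open>n\<close> the function searched may be undefined, so its values
    are chosen only up to \<open>n\<close>, where the first zero occurs.\<close>
  then have "\<forall>m. \<exists>y. m \<le> n \<longrightarrow> computes f (m # map s js) y \<and> (y = 0 \<longleftrightarrow> m = n)"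
    by (metis nat_less_le nat.distinct(1))
  then obtain v where v: "\<And>m. m \<le> n \<Longrightarrow> computes f (m # map s js) (v m)"
      "\<And>m. m \<le> n \<Longrightarrow> v m = 0 \<longleftrightarrow> m = n"
    by metis
  have sz: "s (k + i) = 0" "s k = 0" "s (Suc k) = 0" "s (Suc (Suc k)) = 0" for i
    using s by auto
  have run: "exec (compile f (k # js) (k + 1) (k + 2)) (s(k := m)) (s(k := m, k + 1 := v m))"
    if "m \<le> n" for m
    by (rule implementsD[OF f v(1)[OF that]])
       (use js s sz \<open>r < k\<close> in \<open>auto simp: less_SucI\<close>)
  let ?\<sigma> = "\<lambda>m. s(k := m, k + 1 := v m)"
  have 1: "exec (compile f (k # js) (k + 1) (k + 2)) s (?\<sigma> 0)"
    using run[of 0] by (simp add: fun_upd_idem sz)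
  have 2: "exec (Seq (clear (k + 1)) (Seq (Inc k) (compile f (k # js) (k + 1) (k + 2))))
      (?\<sigma> m) (?\<sigma> (Suc m))" if "m < n" for m
  proof -
    have "exec (clear (k + 1)) (?\<sigma> m) (s(k := m))"
      by (rule exec_eq[OF exec_clear]) (auto simp: fun_eq_iff sz)
    moreover have "exec (Inc k) (s(k := m)) (s(k := Suc m))"
      by (rule exec_eq[OF exec_Inc]) auto
    ultimately show ?thesis using run[of "Suc m"] that by (auto intro: exec_Seq)
  qed
  have 3: "exec (While (k + 1) (Seq (clear (k + 1)) (Seq (Inc k) (compile f (k # js) (k + 1) (k + 2)))))
      (?\<sigma> 0) (?\<sigma> n)"
    by (rule exec_While[where \<sigma> = ?\<sigma> and n = n]) (use 2 v(2) in auto)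
  have 4: "exec (move k r) (?\<sigma> n) (s(r := n))"
    by (rule exec_eq[OF exec_move])
       (use \<open>r < k\<close> \<open>s r = 0\<close> sz v(2)[of n] in \<open>auto simp: fun_eq_iff\<close>)
  show "exec (compile (Mu f) js r k) s (s(r := n))"
    using 1 3 4 by (auto intro!: exec_Seq)
qed

theorem implements_compile: "implements (compile f) f"
proof (induction f)
  case Zero
  then show ?case
    by (auto simp: implements_def elim!: computes_ZeroE intro!: exec_clear)
next
  case Succ
  show ?case unfolding implements_def
  proof (intro allI impI)
    fix js :: "nat list" and r k y :: nat and s :: "nat \<Rightarrow> nat"
    assume c: "computes Succ (map s js) y" and *: "\<forall>j\<in>set js. j < k" "r < k"
      "r \<notin> set js" "s r = 0" "\<forall>i\<ge>k. s i = 0"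
    then obtain a where "js = [a]" "y = Suc (s a)" by (auto elim: computes_SuccE)
    with * show "exec (compile Succ js r k) s (s(r := y))"
      by (auto intro!: exec_Seq[OF exec_copy exec_eq[OF exec_Inc]])
  qed
next
  case (Proj i)
  show ?case unfolding implements_def
  proof (intro allI impI)
    fix js :: "nat list" and r k y :: nat and s :: "nat \<Rightarrow> nat"
    assume c: "computes (Proj i) (map s js) y" and *: "\<forall>j\<in>set js. j < k" "r < k"
      "r \<notin> set js" "s r = 0" "\<forall>i\<ge>k. s i = 0"
    then have i: "i < length js" "y = s (js ! i)" by (auto elim: computes_ProjE)
    then have "js ! i < k" "js ! i \<noteq> r" using * nth_mem by metis+
    with * i show "exec (compile (Proj i) js r k) s (s(r := y))"
      by (auto intro!: exec_eq[OF exec_copy])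
  qed
next
  case (Comp f gs)
  then show ?case by (intro implements_Comp)
next
  case (PrimRec f g)
  then show ?case by (intro implements_PrimRec)
next
  case (Mu f)
  then show ?case by (intro implements_Mu)
qed

section \<open>Recursive arithmetic\<close>

definition recursive_fn :: "nat \<Rightarrow> (nat list \<Rightarrow> nat) \<Rightarrow> bool" where
  "recursive_fn k h \<longleftrightarrow> (\<exists>f. \<forall>xs. length xs = k \<longrightarrow> computes f xs (h xs))"

lemma recursive_fn_comp_list:
  assumes f: "\<And>ys. length ys = length hs \<Longrightarrow> computes f ys (h ys)"
    and hs: "\<And>g. g \<in> set hs \<Longrightarrow> recursive_fn k g"
  shows "recursive_fn k (\<lambda>xs. h (map (\<lambda>g. g xs) hs))"
proof -
  obtain F where F: "\<And>g xs. g \<in> set hs \<Longrightarrow> length xs = k \<Longrightarrow> computes (F g) xs (g xs)"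
    using hs unfolding recursive_fn_def by metis
  have "computes (Comp f (map F hs)) xs (h (map (\<lambda>g. g xs) hs))" if "length xs = k" for xs
    by (rule computes.Comp[OF _ f]) (auto simp: list_all2_conv_all_nth F that)
  then show ?thesis unfolding recursive_fn_def by blast
qed

lemma recursive_fn_proj: "i < k \<Longrightarrow> recursive_fn k (\<lambda>xs. xs ! i)"
  unfolding recursive_fn_def by (auto intro!: exI[of _ "Proj i"] computes.Proj)

lemma recursive_fn_Suc: "recursive_fn k h \<Longrightarrow> recursive_fn k (\<lambda>xs. Suc (h xs))"
  using recursive_fn_comp_list[of "[h]" Succ "\<lambda>ys. Suc (hd ys)" k]
  by (force simp: length_Suc_conv intro: computes.Succ)

lemma recursive_fn_const: "recursive_fn k (\<lambda>_. c)"
proof (induction c)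
  case 0
  then show ?case unfolding recursive_fn_def by (auto intro: computes.Zero)
qed (rule recursive_fn_Suc)

lemma recursive_fn_rec:
  assumes "recursive_fn k h" "recursive_fn k b" "recursive_fn (k + 2) s"
  shows "recursive_fn k (\<lambda>xs. rec_nat (b xs) (\<lambda>n r. s (n # r # xs)) (h xs))"
proof -
  obtain fb fs where f: "\<And>xs. length xs = k \<Longrightarrow> computes fb xs (b xs)"
      "\<And>xs. length xs = k + 2 \<Longrightarrow> computes fs xs (s xs)"
    using assms(2,3) unfolding recursive_fn_def by blast
  have rec: "computes (PrimRec fb fs) (n # xs) (rec_nat (b xs) (\<lambda>n r. s (n # r # xs)) n)"
    if "length xs = k" for n xs
    by (induction n) (auto intro!: computes.PrimRec_0 computes.PrimRec_Suc f that)
  \<comment> \<open>Composition with \<open>h\<close> and all projections puts the recursion bound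
    in front of an unchanged copy of the arguments, the order that \<open>PrimRec\<close>
    expects.\<close>
  let ?hs = "h # map (\<lambda>i xs. xs ! i) [0..<k]"
  have "recursive_fn k (\<lambda>xs. (\<lambda>ys. rec_nat (b (tl ys)) (\<lambda>n r. s (n # r # tl ys)) (hd ys))
      (map (\<lambda>g. g xs) ?hs))"
    by (rule recursive_fn_comp_list)
       (auto simp: length_Suc_conv intro!: rec assms recursive_fn_proj)
  moreover have "map (\<lambda>g. g xs) (map (\<lambda>i xs. xs ! i) [0..<k]) = xs" if "length xs = k" for xs :: "nat list"
    by (rule nth_equalityI) (auto simp: that)
  ultimately show ?thesis unfolding recursive_fn_def by (auto simp del: map_map)
qed

lemma recursive_fn_add:
  assumes "recursive_fn k g" "recursive_fn k h"
  shows "recursive_fn k (\<lambda>xs. g xs + h xs)"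
proof -
  have "recursive_fn k (\<lambda>xs. rec_nat (g xs) (\<lambda>n r. Suc ((n # r # xs) ! 1)) (h xs))"
    by (rule recursive_fn_rec[OF assms(2,1)]) (auto intro!: recursive_fn_Suc recursive_fn_proj)
  moreover have "rec_nat a (\<lambda>n r. Suc r) b = a + b" for a b :: nat
    by (induction b) auto
  ultimately show ?thesis by simp
qed

lemma recursive_fn_sum:
  assumes g: "recursive_fn 1 (\<lambda>xs. g (xs ! 0))" and h: "recursive_fn k h"
  shows "recursive_fn k (\<lambda>xs. \<Sum>j<h xs. g j)"
proof -
  have "recursive_fn (k + 2) (\<lambda>xs. g (map (\<lambda>f. f xs) [\<lambda>xs. xs ! 0] ! 0))"
  proof -
    obtain f where f: "\<And>xs. length xs = 1 \<Longrightarrow> computes f xs (g (xs ! 0))"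
      using g unfolding recursive_fn_def by blast
    show ?thesis
      by (rule recursive_fn_comp_list[where h = "\<lambda>ys. g (ys ! 0)"])
         (auto intro!: f recursive_fn_proj)
  qed
  then have "recursive_fn (k + 2) (\<lambda>xs. xs ! 1 + g (xs ! 0))"
    by (intro recursive_fn_add recursive_fn_proj) auto
  then have "recursive_fn k (\<lambda>xs. rec_nat 0 (\<lambda>n r. (n # r # xs) ! 1 + g ((n # r # xs) ! 0)) (h xs))"
    by (intro recursive_fn_rec h recursive_fn_const)
  moreover have "rec_nat 0 (\<lambda>n r. r + g n) b = (\<Sum>j<b. g j)" for b
    by (induction b) auto
  ultimately show ?thesis by simp
qed

lemma recursive_fn_sum_set:
  "finite I \<Longrightarrow> (\<And>i. i \<in> I \<Longrightarrow> recursive_fn k (g i)) \<Longrightarrow> recursive_fn k (\<lambda>xs. \<Sum>i\<in>I. g i xs)"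
  by (induction I rule: finite_induct) (auto intro!: recursive_fn_const recursive_fn_add)

lemma recursive_fn_power2:
  assumes "recursive_fn k h"
  shows "recursive_fn k (\<lambda>xs. 2 ^ h xs)"
proof -
  have "recursive_fn k (\<lambda>xs. rec_nat 1 (\<lambda>n r. (n # r # xs) ! 1 + (n # r # xs) ! 1) (h xs))"
    by (rule recursive_fn_rec[OF assms recursive_fn_const])
       (intro recursive_fn_add recursive_fn_proj; simp)+
  moreover have "rec_nat 1 (\<lambda>n r. r + r) b = (2 :: nat) ^ b" for b
    by (induction b) auto
  ultimately show ?thesis by simp
qed

text \<open>The Cantor pairing of \<open>a\<close> and \<open>b\<close> is the triangular number of
  \<open>a + b\<close> plus \<open>a\<close>, and triangular numbers are sums.\<close>

lemma recursive_fn_prod_encode: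
  assumes "recursive_fn k g" "recursive_fn k h"
  shows "recursive_fn k (\<lambda>xs. prod_encode (g xs, h xs))"
proof -
  have "recursive_fn 1 (\<lambda>xs. Suc (xs ! 0))"
    by (intro recursive_fn_Suc recursive_fn_proj) simp
  then have "recursive_fn k (\<lambda>xs. \<Sum>j<g xs + h xs. Suc j)"
    by (intro recursive_fn_sum recursive_fn_add assms)
  moreover have "(\<Sum>j<n. Suc j) = triangle n" for n
    by (induction n) auto
  ultimately show ?thesis
    using recursive_fn_add[OF _ assms(1)] by (simp add: prod_encode_def)
qed

section \<open>Octants in the Diestel--Leader graph\<close>

text \<open>Intended use: zero words get \<open>Neg\<close>, \<open>Chain\<close> or
  \<open>Run\<close> for markers below 0, from 0 to \<open>N\<close>, and above \<open>N\<close>;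
  \<open>(k, e\<^sub>n)\<close> gets \<open>Row\<close> for \<open>k < n\<close> and
  \<open>Top\<close> for \<open>k = n\<close>; \<open>(n + 1, e\<^sub>k)\<close> with
  \<open>k \<le> n\<close> gets \<open>Col\<close>; \<open>(m, e\<^sub>k + e\<^sub>n)\<close> with
  \<open>k < m \<le> n\<close> gets \<open>Cell\<close>; all else is \<open>Junk\<close>.\<close>

datatype 'v colour =
  Junk | Neg | Run | Chain nat | Row 'v | Top 'v | Col 'v | Cell 'v

text \<open>\<open>bot\<close> fills the columns left of the octant, so \<open>H bot\<close>
  constrains its left edge. \<open>H\<close> relates neighbours in a row, \<open>W\<close>
  neighbours in a column, and \<open>top\<close> constrains the diagonal, where each row ends.
  \<open>ll\<close> and \<open>lp\<close> are the diagonal letters of the loading phase,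
  \<open>lp\<close> being allowed only in its last row; \<open>start\<close> opens the computation
  proper.\<close>

locale octant_system =
  fixes V :: "'v set" and bot :: 'v and H W :: "'v \<Rightarrow> 'v \<Rightarrow> bool" and top start :: "'v \<Rightarrow> bool"
    and ll lp :: 'v
  assumes bot_ll: "bot \<noteq> ll" and bot_lp: "bot \<noteq> lp" and ll_lp: "ll \<noteq> lp"
    and bot_V: "bot \<in> V" and ll_V: "ll \<in> V" and lp_V: "lp \<in> V" and finite_V: "finite V"
    and H_bot: "H bot bot" and W_bot: "W bot v \<longleftrightarrow> v = bot" and W_to_bot: "W v bot \<Longrightarrow> v = bot"
    and top_bot: "top bot"
    and not_start_bot: "\<not> start bot"
begin

definition octant_tiling :: "nat \<Rightarrow> (nat \<Rightarrow> nat \<Rightarrow> 'v) \<Rightarrow> bool" where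
  "octant_tiling N v \<longleftrightarrow>
     (\<forall>k n. k \<le> n \<longrightarrow> v k n \<in> V \<and> v k n \<noteq> bot \<and> W (v k n) (v k (Suc n))) \<and>
     (\<forall>k n. k < n \<longrightarrow> H (v k n) (v (Suc k) n)) \<and>
     (\<forall>n. H bot (v 0 n) \<and> top (v n n)) \<and>
     (\<forall>n. (n < N \<longrightarrow> v n n \<in> {ll, lp}) \<and> (Suc n < N \<longrightarrow> v n n = ll)) \<and> start (v N N)"

text \<open>A label with a digit above 1 occurs only at an end coloured \<open>Junk\<close>. A rule
  with \<open>Chain (Suc j)\<close> mentions no letter other than \<open>bot\<close>,
  \<open>ll\<close> and \<open>lp\<close>, so what a longer countdown adds to the rules is the same
  for every machine up to renaming.\<close>

inductive ok :: "'v colour \<Rightarrow> nat \<times> nat \<Rightarrow> 'v colour \<Rightarrow> bool" where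
  Junk_Junk: "ok Junk l Junk"
| Junk_Neg: "2 \<le> a \<Longrightarrow> ok Junk (a, 0) Neg"
| Junk_Chain: "2 \<le> a \<Longrightarrow> ok Junk (a, 0) (Chain j)"
| Junk_Run: "2 \<le> a \<Longrightarrow> ok Junk (a, 0) Run"
| Junk_Col: "2 \<le> a \<Longrightarrow> ok Junk (a, b) (Col v)"
| Junk_Row: "1 \<le> a \<Longrightarrow> ok Junk (a, b) (Row v)"
| Junk_Top: "1 \<le> a \<Longrightarrow> ok Junk (a, b) (Top v)"
| Junk_Cell: "1 \<le> a \<Longrightarrow> ok Junk (a, b) (Cell v)"
| Neg_Junk: "2 \<le> b \<Longrightarrow> ok Neg (0, b) Junk"
| Chain_Junk: "2 \<le> b \<Longrightarrow> ok (Chain j) (0, b) Junk"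
| Run_Junk: "2 \<le> b \<Longrightarrow> ok Run (0, b) Junk"
| Row_Junk: "2 \<le> b \<Longrightarrow> ok (Row v) (a, b) Junk"
| Top_Junk: "2 \<le> b \<Longrightarrow> ok (Top v) (a, b) Junk"
| Col_Junk: "1 \<le> b \<Longrightarrow> ok (Col v) (a, b) Junk"
| Cell_Junk: "1 \<le> b \<Longrightarrow> ok (Cell v) (a, b) Junk"
| Neg_Neg: "ok Neg (0, 0) Neg"
| Neg_Chain: "ok Neg (0, 0) (Chain j)"
| Chain_Chain: "ok (Chain (Suc j)) (0, 0) (Chain j)"
| Chain_Run: "ok (Chain 0) (0, 0) Run"
| Run_Run: "ok Run (0, 0) Run"
| Neg_Col: "ok Neg (0, 1) (Col bot)"
| Chain_Col_ll: "ok (Chain (Suc j)) (0, 1) (Col ll)"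
| Chain_Col_lp: "ok (Chain (Suc j)) (0, 1) (Col lp)"
| Chain_Col_start: "start v \<Longrightarrow> ok (Chain 0) (0, 1) (Col v)"
| Run_Col: "v \<noteq> bot \<Longrightarrow> ok Run (0, 1) (Col v)"
| Top_Neg: "ok (Top v) (1, 0) Neg"
| Top_Run: "ok (Top v) (1, 0) Run"
| Top_Chain_0: "ok (Top v) (1, 0) (Chain 0)"
| Top_Chain_bot: "ok (Top bot) (1, 0) (Chain (Suc j))"
| Top_Chain_ll: "ok (Top ll) (1, 0) (Chain (Suc j))"
| Top_Col: "ok (Top v) (1, 1) (Col v)"
| Row_Row: "H v v' \<Longrightarrow> ok (Row v) (0, 0) (Row v')"
| Row_Top: "H v v' \<Longrightarrow> top v' \<Longrightarrow> ok (Row v) (0, 0) (Top v')"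
| Row_Cell: "ok (Row v) (0, 1) (Cell v)"
| Cell_Cell: "ok (Cell v) (0, 0) (Cell v)"
| Cell_Col: "ok (Cell v) (1, 0) (Col v)"
| Col_Col: "W v v' \<Longrightarrow> ok (Col v) (0, 0) (Col v')"

definition colours :: "nat \<Rightarrow> 'v colour set" where
  "colours N = {Junk, Neg, Run} \<union> Chain ` {..N} \<union> Row ` V \<union> Top ` V \<union> Col ` V \<union> Cell ` V"

definition rules :: "nat \<Rightarrow> nat \<Rightarrow> nat \<Rightarrow> 'v colour rule set" where
  "rules p q N = {(c, l, d). c \<in> colours N \<and> l \<in> {0..<p} \<times> {0..<q} \<and> d \<in> colours N \<and> ok c l d}"

lemma finite_colours: "finite (colours N)"
  unfolding colours_def using finite_V by simp

lemma finite_rules: "finite (rules p q N)"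
proof (rule finite_subset)
  show "rules p q N \<subseteq> colours N \<times> ({0..<p} \<times> {0..<q}) \<times> colours N"
    unfolding rules_def by auto
qed (simp add: finite_colours)

inductive_cases ok_to_ChainE: "ok c (0, 0) (Chain j)"
inductive_cases ok_from_ChainE: "ok (Chain j) (0, 0) c"
inductive_cases ok_from_RunE: "ok Run (0, 0) c"
inductive_cases ok_Neg_1E: "ok Neg (0, Suc 0) c"
inductive_cases ok_Chain_1E: "ok (Chain j) (0, Suc 0) c"
inductive_cases ok_Run_1E: "ok Run (0, Suc 0) c"
inductive_cases ok_1_ColE: "ok c (Suc 0, Suc 0) (Col v)"
inductive_cases ok_10_ColE: "ok c (Suc 0, 0) (Col v)"
inductive_cases ok_Col_0E: "ok (Col v) (0, 0) c"
inductive_cases ok_to_CellE: "ok c (0, 0) (Cell v)"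
inductive_cases ok_01_CellE: "ok c (0, Suc 0) (Cell v)"
inductive_cases ok_to_TopE: "ok c (0, 0) (Top v)"
inductive_cases ok_to_RowE: "ok c (0, 0) (Row v)"
inductive_cases ok_Top_ChainE: "ok (Top v) (Suc 0, 0) (Chain j)"

section \<open>From a tiling to an octant: words with at most two ones\<close>

definition hot1 :: "int \<Rightarrow> int \<Rightarrow> nat" where
  "hot1 k = (\<lambda>_. 0)(k := 1)"

definition hot2 :: "int \<Rightarrow> int \<Rightarrow> int \<Rightarrow> nat" where
  "hot2 k n = (\<lambda>_. 0)(k := 1, n := 1)"

context
  fixes p q N :: nat and \<kappa> :: "vertex \<Rightarrow> 'v colour"
  assumes pq: "2 \<le> p" "2 \<le> q"
    and seed: "\<kappa> DL_seed = Chain N"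
    and edges: "\<And>u v. (u, v) \<in> DL_edges p q \<Longrightarrow> (\<kappa> u, DL_label (u, v), \<kappa> v) \<in> rules p q N"
begin

text \<open>Digits 0 and 1 are legal on both sides of the marker because \<open>p\<close> and
  \<open>q\<close> are at least 2, so such words give vertices at every marker position.\<close>

lemma edge_ok:
  assumes "finite {i. x i \<noteq> 0}" "\<And>i. x i \<le> 1" "\<And>i. y i \<le> 1" "\<And>i. i \<noteq> m \<Longrightarrow> x i = y i"
  shows "(\<kappa> (m, x), (x m, y m), \<kappa> (m + 1, y)) \<in> rules p q N"
proof -
  have "finite {i. y i \<noteq> 0}"
    by (rule finite_subset[of _ "insert m {i. x i \<noteq> 0}"]) (use assms in auto)
  moreover have "x i < p" "x i < q" "y i < p" "y i < q" for i
    using assms(2)[of i] assms(3)[of i] pq by linarith+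
  ultimately have "((m, x), (m + 1, y)) \<in> DL_edges p q"
    using assms(1,4) unfolding DL_edges_def DL_verts_def by auto
  then show ?thesis using edges by fastforce
qed

lemma hot_edges:
  "(\<kappa> (m, \<lambda>_. 0), (0, 0), \<kappa> (m + 1, \<lambda>_. 0)) \<in> rules p q N"
  "(\<kappa> (m, \<lambda>_. 0), (0, 1), \<kappa> (m + 1, hot1 m)) \<in> rules p q N"
  "(\<kappa> (m, hot1 m), (1, 0), \<kappa> (m + 1, \<lambda>_. 0)) \<in> rules p q N"
  "(\<kappa> (m, hot1 m), (1, 1), \<kappa> (m + 1, hot1 m)) \<in> rules p q N"
  "m \<noteq> n \<Longrightarrow> (\<kappa> (m, hot1 n), (0, 0), \<kappa> (m + 1, hot1 n)) \<in> rules p q N"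
  "m \<noteq> n \<Longrightarrow> (\<kappa> (m, hot1 n), (0, 1), \<kappa> (m + 1, hot2 m n)) \<in> rules p q N"
  "m \<noteq> n \<Longrightarrow> m \<noteq> k \<Longrightarrow> (\<kappa> (m, hot2 k n), (0, 0), \<kappa> (m + 1, hot2 k n)) \<in> rules p q N"
  "k \<noteq> m \<Longrightarrow> (\<kappa> (m, hot2 k m), (1, 0), \<kappa> (m + 1, hot1 k)) \<in> rules p q N"
proof -
  have fin: "finite {i. hot1 n i \<noteq> 0}" "finite {i. hot2 k n i \<noteq> 0}" for n k
    by (auto intro: finite_subset[of _ "{k, n}"] simp: hot1_def hot2_def)
  have le: "hot1 n i \<le> 1" "hot2 k n i \<le> 1" for n k i
    by (auto simp: hot1_def hot2_def)
  show "(\<kappa> (m, \<lambda>_. 0), (0, 0), \<kappa> (m + 1, \<lambda>_. 0)) \<in> rules p q N"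
    using edge_ok[of "\<lambda>_. 0" "\<lambda>_. 0" m] by simp
  show "(\<kappa> (m, \<lambda>_. 0), (0, 1), \<kappa> (m + 1, hot1 m)) \<in> rules p q N"
    using edge_ok[of "\<lambda>_. 0" "hot1 m" m] le by (simp add: hot1_def)
  show "(\<kappa> (m, hot1 m), (1, 0), \<kappa> (m + 1, \<lambda>_. 0)) \<in> rules p q N"
    using edge_ok[of "hot1 m" "\<lambda>_. 0" m] le fin by (simp add: hot1_def)
  show "(\<kappa> (m, hot1 m), (1, 1), \<kappa> (m + 1, hot1 m)) \<in> rules p q N"
    using edge_ok[of "hot1 m" "hot1 m" m] le fin by (simp add: hot1_def)
  show "(\<kappa> (m, hot1 n), (0, 0), \<kappa> (m + 1, hot1 n)) \<in> rules p q N" if "m \<noteq> n"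
    using edge_ok[of "hot1 n" "hot1 n" m] le fin that by (simp add: hot1_def)
  show "(\<kappa> (m, hot1 n), (0, 1), \<kappa> (m + 1, hot2 m n)) \<in> rules p q N" if "m \<noteq> n"
    using edge_ok[of "hot1 n" "hot2 m n" m] le fin that by (simp add: hot1_def hot2_def)
  show "(\<kappa> (m, hot2 k n), (0, 0), \<kappa> (m + 1, hot2 k n)) \<in> rules p q N" if "m \<noteq> n" "m \<noteq> k"
    using edge_ok[of "hot2 k n" "hot2 k n" m] le fin that by (simp add: hot2_def)
  show "(\<kappa> (m, hot2 k m), (1, 0), \<kappa> (m + 1, hot1 k)) \<in> rules p q N" if "k \<noteq> m"
    using edge_ok[of "hot2 k m" "hot1 k" m] le fin that by (simp add: hot1_def hot2_def)
qed

lemma Chain_bound: "(Chain j, l, c) \<in> rules p q N \<Longrightarrow> j \<le> N"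
  by (auto simp: rules_def colours_def)

lemma rules_ok: "(c, l, d) \<in> rules p q N \<Longrightarrow> ok c l d"
  by (auto simp: rules_def)

lemmas hot_ok = hot_edges[THEN rules_ok, unfolded One_nat_def]

lemma base_Chain: "j \<le> N \<Longrightarrow> \<kappa> (int j, \<lambda>_. 0) = Chain (N - j)"
proof (induction j)
  case 0
  then show ?case using seed by (simp add: DL_seed_def)
next
  case (Suc j)
  then have "N - j = Suc (N - Suc j)" "\<kappa> (int j, \<lambda>_. 0) = Chain (N - j)" by simp_all
  then have "ok (Chain (Suc (N - Suc j))) (0, 0) (\<kappa> (int j + 1, \<lambda>_. 0))"
    using hot_ok(1)[of "int j"] by simp
  then show ?case by (auto elim: ok_from_ChainE simp: add.commute)
qed

lemma base_Run: "\<kappa> (int (Suc N + j), \<lambda>_. 0) = Run"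
proof (induction j)
  case 0
  have "ok (Chain 0) (0, 0) (\<kappa> (int N + 1, \<lambda>_. 0))"
    using hot_ok(1)[of "int N"] base_Chain[of N] by simp
  then show ?case by (auto elim: ok_from_ChainE simp: add.commute)
next
  case (Suc j)
  then have "ok Run (0, 0) (\<kappa> (int (Suc N + j) + 1, \<lambda>_. 0))"
    using hot_ok(1)[of "int (Suc N + j)"] by simp
  then show ?case by (auto elim: ok_from_RunE simp: add_ac)
qed

text \<open>On label (0,0) the rules allow only \<open>Neg\<close> and \<open>Chain (Suc N)\<close>
  below \<open>Chain N\<close>, and the latter is not in \<open>colours N\<close>. So the countdown
  cannot start below the seed.\<close>

lemma base_Neg: "\<kappa> (- 1, \<lambda>_. 0) = Neg"
proof -
  have *: "(\<kappa> (- 1, \<lambda>_. 0), (0, 0), Chain N) \<in> rules p q N"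
    using hot_edges(1)[of "-1"] seed by (simp add: DL_seed_def)
  have "\<kappa> (- 1, \<lambda>_. 0) \<noteq> Chain (Suc N)"
    using * Chain_bound[of "Suc N"] by auto
  then show ?thesis using rules_ok[OF *] by (auto elim!: ok_to_ChainE)
qed

text \<open>The letter \<open>v k n\<close>, for \<open>k \<le> n\<close>, is read off the column vertex \<open>(n + 1, hot1 k)\<close>.\<close>

lemma column_Suc:
  assumes "\<kappa> (n + 1, hot1 k) = Col v" "k \<le> n"
  shows "\<exists>v'. \<kappa> (n + 1 + 1, hot1 k) = Col v' \<and> W v v'"
proof -
  have "ok (Col v) (0, 0) (\<kappa> (n + 1 + 1, hot1 k))"
    using hot_ok(5)[of "n + 1" k] assms by simp
  then show ?thesis by (auto elim: ok_Col_0E)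
qed

lemma diagonal_Top:
  assumes "\<kappa> (n + 1, hot1 n) = Col v"
  shows "\<kappa> (n, hot1 n) = Top v"
  using hot_ok(4)[of n] assms by (auto elim: ok_1_ColE)

text \<open>Only \<open>Cell v\<close> may precede \<open>Col v\<close> on label (1,0) or
  \<open>Cell v\<close> on label (0,0), so the letter can be traced downwards along the path;
  \<open>i\<close> counts the steps down from marker \<open>n\<close>.\<close>

lemma column_Cell:
  assumes "\<kappa> (n + 1, hot1 k) = Col v" "k + int i < n"
  shows "\<kappa> (n - int i, hot2 k n) = Cell v"
  using assms(2)
proof (induction i)
  case 0
  then show ?case using hot_ok(8)[of k n] assms by (auto elim: ok_10_ColE)
next
  case (Suc i)
  then have "ok (\<kappa> (n - int (Suc i), hot2 k n)) (0, 0) (Cell v)"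
    using hot_ok(7)[of "n - int (Suc i)" n k] by simp
  then show ?case by (auto elim: ok_to_CellE)
qed

lemma column_Row:
  assumes "\<kappa> (n + 1, hot1 k) = Col v" "k < n"
  shows "\<kappa> (k, hot1 n) = Row v"
proof -
  \<comment> \<open>The path runs over the markers \<open>k + 1\<close> to \<open>n\<close>, hence
    \<open>n - k - 1\<close> steps down.\<close>
  have "\<kappa> (k + 1, hot2 k n) = Cell v"
    using column_Cell[OF assms(1), of "nat (n - k - 1)"] assms(2) by simp
  then show ?thesis using hot_ok(6)[of k n] assms(2) by (auto elim: ok_01_CellE)
qed

text \<open>The two column letters reappear at the adjacent vertices \<open>(k, hot1 n)\<close> and
  \<open>(k + 1, hot1 n)\<close>, and the rule of their edge imposes \<open>H\<close>, and also
  \<open>top\<close> if the upper one lies on the diagonal. The integer \<open>k\<close> may be -1,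
  the border column.\<close>

lemma column_H:
  assumes "\<kappa> (n + 1, hot1 k) = Col v" "\<kappa> (n + 1, hot1 (k + 1)) = Col v'" "k < n"
  shows "H v v'" "k + 1 = n \<Longrightarrow> top v'"
proof -
  have "ok (Row v) (0, 0) (\<kappa> (k + 1, hot1 n))"
    using hot_ok(5)[of k n] column_Row[OF assms(1,3)] assms(3) by simp
  moreover have "\<kappa> (k + 1, hot1 n) = (if k + 1 = n then Top v' else Row v')"
    using column_Row[OF assms(2)] diagonal_Top[of n v'] assms(2,3) by auto
  ultimately show "H v v'" "k + 1 = n \<Longrightarrow> top v'"
    by (auto elim: ok_to_TopE ok_to_RowE split: if_splits)
qed

text \<open>Column \<open>n\<close> starts above the zero word with marker \<open>n\<close>, whose
  colour \<open>Chain (N - n)\<close> or \<open>Run\<close> restricts the first letter.\<close>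

lemma diagonal_Col:
  "\<exists>v. \<kappa> (int n + 1, hot1 (int n)) = Col v \<and> v \<noteq> bot \<and> (n < N \<longrightarrow> v \<in> {ll, lp}) \<and>
     (n = N \<longrightarrow> start v)"
proof (cases "n \<le> N")
  case True
  have *: "ok (Chain (N - n)) (0, Suc 0) (\<kappa> (int n + 1, hot1 (int n)))"
    using hot_ok(2)[of "int n"] base_Chain[OF True] by simp
  show ?thesis
  proof (cases "n = N")
    case True
    then show ?thesis using * not_start_bot by (auto elim!: ok_Chain_1E)
  next
    case False
    with True show ?thesis using * bot_ll bot_lp by (auto elim!: ok_Chain_1E)
  qed
next
  case False
  then obtain j where "n = Suc N + j" by (metis less_eq_Suc_le not_le le_iff_add)
  then have "ok Run (0, Suc 0) (\<kappa> (int n + 1, hot1 (int n)))"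
    using hot_ok(2)[of "int n"] base_Run[of j] by simp
  with False show ?thesis by (auto elim!: ok_Run_1E)
qed

lemma column_Col: "\<exists>v. \<kappa> (int (k + i) + 1, hot1 (int k)) = Col v \<and> v \<noteq> bot"
proof (induction i)
  case 0
  then show ?case using diagonal_Col[of k] by auto
next
  case (Suc i)
  then obtain v where v: "\<kappa> (int (k + i) + 1, hot1 (int k)) = Col v" "v \<noteq> bot" by blast
  obtain v' where v': "\<kappa> (int (k + i) + 1 + 1, hot1 (int k)) = Col v'" "W v v'"
    using column_Suc[OF v(1)] by auto
  then show ?case using W_to_bot v(2) by (auto simp: add_ac)
qed

text \<open>The border column starts above the vertex coloured \<open>Neg\<close> at marker -1,
  which forces \<open>bot\<close>, and \<open>W\<close> preserves \<open>bot\<close>.\<close>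

lemma column_bot: "\<kappa> (int n, hot1 (- 1)) = Col bot"
proof (induction n)
  case 0
  show ?case using hot_ok(2)[of "-1"] base_Neg by (auto elim: ok_Neg_1E)
next
  case (Suc n)
  have "ok (Col bot) (0, 0) (\<kappa> (int n + 1, hot1 (- 1)))"
    using hot_ok(5)[of "int n" "-1"] Suc by simp
  then show ?case by (auto elim!: ok_Col_0E simp: W_bot add.commute)
qed

lemma octant_of_tiling: "\<exists>v. octant_tiling N v"
proof -
  have "\<exists>v. k \<le> n \<longrightarrow> \<kappa> (int n + 1, hot1 (int k)) = Col v \<and> v \<noteq> bot" for k n
    using column_Col[of k "n - k"] by auto
  then obtain v where v: "\<And>k n. k \<le> n \<Longrightarrow> \<kappa> (int n + 1, hot1 (int k)) = Col (v k n)"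
      "\<And>k n. k \<le> n \<Longrightarrow> v k n \<noteq> bot"
    by metis
  have inV: "v k n \<in> V" if "k \<le> n" for k n
  proof -
    \<comment> \<open>The vertex is an end of an edge, and rules mention only colours of
      \<open>colours N\<close>, whose letters lie in \<open>V\<close>.\<close>
    have "(Col (v k n), (0, 0), \<kappa> (int n + 1 + 1, hot1 (int k))) \<in> rules p q N"
      using hot_edges(5)[of "int n + 1" "int k"] v(1)[OF that] that by simp
    then show ?thesis by (auto simp: rules_def colours_def)
  qed
  have W: "W (v k n) (v k (Suc n))" if "k \<le> n" for k n
    using column_Suc[OF v(1)[OF that]] v(1)[of k "Suc n"] that by (simp add: algebra_simps)
  have H: "H (v k n) (v (Suc k) n)" if "k < n" for k n
    using column_H(1)[OF v(1)[of k n], of "v (Suc k) n"] v(1)[of "Suc k" n] that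
    by (simp add: algebra_simps)
  have H0: "H bot (v 0 n)" for n
    using column_H(1)[of "int n" "-1" bot "v 0 n"] v(1)[of 0 n] column_bot[of "Suc n"]
    by (simp add: algebra_simps)
  have top: "top (v n n)" for n
  proof (cases n)
    case 0
    \<comment> \<open>Place 0 of row 0 has no left neighbour in the octant; the border column takes
      that role.\<close>
    then show ?thesis
      using column_H(2)[of "0" "-1" bot "v 0 0"] v(1)[of 0 0] column_bot[of 1] by simp
  next
    case (Suc m)
    then show ?thesis
      using column_H(2)[OF v(1)[of m n], of "v n n"] v(1)[of n n] by (simp add: algebra_simps)
  qed
  have diag: "n < N \<Longrightarrow> v n n \<in> {ll, lp}" "n = N \<Longrightarrow> start (v n n)" for n
    using diagonal_Col[of n] v(1)[of n n] by auto
  \<comment> \<open>The edge with label (1,0) from the diagonal vertex to a zero word meets a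
    countdown that is still positive, which admits only \<open>bot\<close> and
    \<open>ll\<close>.\<close>
  have "v n n = ll" if "Suc n < N" for n
  proof -
    have "\<kappa> (int n + 1, \<lambda>_. 0) = Chain (Suc (N - n - 2))"
      using base_Chain[of "Suc n"] that by (simp add: algebra_simps Suc_diff_Suc numeral_2_eq_2)
    then have "ok (Top (v n n)) (Suc 0, 0) (Chain (Suc (N - n - 2)))"
      using hot_ok(3)[of "int n"] diagonal_Top[OF v(1)[of n n]] by simp
    then show ?thesis using diag(1)[of n] v(2)[of n n] by (auto elim: ok_Top_ChainE)
  qed
  then have "octant_tiling N v"
    unfolding octant_tiling_def using inV v(2) W H H0 top diag by (intro conjI allI impI) auto
  then show ?thesis by blast
qed

end

section \<open>From an octant to a tiling: classes of words on the two sides of the marker\<close>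

datatype zclass = Zeros | One int | Many

definition zclass :: "int set \<Rightarrow> (int \<Rightarrow> nat) \<Rightarrow> zclass" where
  "zclass I x =
     (if \<forall>i\<in>I. x i = 0 then Zeros
      else if \<exists>k\<in>I. x k = 1 \<and> (\<forall>i\<in>I. i \<noteq> k \<longrightarrow> x i = 0) then One (THE k. k \<in> I \<and> x k = 1)
      else Many)"

lemma zclass_Zeros: "zclass I x = Zeros \<longleftrightarrow> (\<forall>i\<in>I. x i = 0)"
  by (simp add: zclass_def)

lemma zclass_One: "zclass I x = One k \<longleftrightarrow> k \<in> I \<and> x k = 1 \<and> (\<forall>i\<in>I. i \<noteq> k \<longrightarrow> x i = 0)"
proof
  assume r: "k \<in> I \<and> x k = 1 \<and> (\<forall>i\<in>I. i \<noteq> k \<longrightarrow> x i = 0)"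
  then have "(THE k. k \<in> I \<and> x k = 1) = k" by (intro the_equality) auto
  with r show "zclass I x = One k" by (auto simp: zclass_def)
next
  assume l: "zclass I x = One k"
  then obtain k' where k': "k' \<in> I" "x k' = 1" "\<forall>i\<in>I. i \<noteq> k' \<longrightarrow> x i = 0"
    by (auto simp: zclass_def split: if_splits)
  then have "(THE k. k \<in> I \<and> x k = 1) = k'" by (intro the_equality) auto
  then have "k = k'" using l by (auto simp: zclass_def split: if_splits)
  with k' show "k \<in> I \<and> x k = 1 \<and> (\<forall>i\<in>I. i \<noteq> k \<longrightarrow> x i = 0)" by blast
qed

lemma zclass_Many:
  "zclass I x = Many \<longleftrightarrow>
     \<not> (\<forall>i\<in>I. x i = 0) \<and> \<not> (\<exists>k\<in>I. x k = 1 \<and> (\<forall>i\<in>I. i \<noteq> k \<longrightarrow> x i = 0))"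
proof -
  have "(if A then Zeros else if B then One c else Many) = Many \<longleftrightarrow> \<not> A \<and> \<not> B" for A B c
    by simp
  then show ?thesis unfolding zclass_def .
qed

lemma zclass_cong:
  assumes "\<And>i. i \<in> I \<Longrightarrow> x i = y i"
  shows "zclass I x = zclass I y"
proof (cases "zclass I y")
  case Zeros
  then have "zclass I x = Zeros" using assms by (simp add: zclass_Zeros)
  with Zeros show ?thesis by simp
next
  case (One k)
  then have "zclass I x = One k" using assms by (simp add: zclass_One)
  with One show ?thesis by simp
next
  case Many
  then have "zclass I x = Many" using assms by (simp add: zclass_Many)
  with Many show ?thesis by simp
qed

text \<open>Moving the marker hands one position over to the other side; only its digit matters for
  the new class of that side.\<close>

lemma zclass_insert:
  assumes "j \<notin> I"
  shows "zclass (insert j I) x = (case zclass I x of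
       Zeros \<Rightarrow> if x j = 0 then Zeros else if x j = 1 then One j else Many
     | One k \<Rightarrow> if x j = 0 then One k else Many
     | Many \<Rightarrow> Many)"
proof (cases "zclass I x")
  case Zeros
  then have I: "\<forall>i\<in>I. x i = 0" by (simp add: zclass_Zeros)
  have "zclass (insert j I) x = (if x j = 0 then Zeros else if x j = 1 then One j else Many)"
    using I by (simp add: zclass_Zeros zclass_One zclass_Many)
  with Zeros show ?thesis by simp
next
  case (One k)
  then have I: "k \<in> I" "x k = 1" "\<forall>i\<in>I. i \<noteq> k \<longrightarrow> x i = 0" by (simp_all add: zclass_One)
  then have "k \<noteq> j" using assms by blast
  with I have "zclass (insert j I) x = (if x j = 0 then One k else Many)"
    by (auto simp add: zclass_One zclass_Many)
  with One show ?thesis by simp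
next
  case Many
  then have "zclass (insert j I) x = Many" using assms unfolding zclass_Many by (metis insert_iff)
  with Many show ?thesis by simp
qed

context
  fixes N :: nat and v :: "nat \<Rightarrow> nat \<Rightarrow> 'v"
  assumes octant: "octant_tiling N v"
begin

definition letter :: "int \<Rightarrow> int \<Rightarrow> 'v" where
  "letter k n = (if k < 0 then bot else v (nat k) (nat n))"

definition base :: "int \<Rightarrow> 'v colour" where
  "base m = (if m < 0 then Neg else if m \<le> int N then Chain (N - nat m) else Run)"

text \<open>The part of the word below the marker supplies the column index \<open>k\<close>, the
  part above it the row index \<open>n\<close>. A column vertex with marker \<open>m\<close> belongs
  to row \<open>m - 1\<close>.\<close>

definition octant_colour :: "vertex \<Rightarrow> 'v colour" where
  "octant_colour = (\<lambda>(m, x). case (zclass {..<m} x, zclass {m..} x) of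
     (Zeros, Zeros) \<Rightarrow> base m
   | (Zeros, One n) \<Rightarrow> if n = m then Top (letter n n) else Row (letter m n)
   | (One k, Zeros) \<Rightarrow> Col (letter k (m - 1))
   | (One k, One n) \<Rightarrow> Cell (letter k n)
   | _ \<Rightarrow> Junk)"

lemma letter_V: "k \<le> n \<Longrightarrow> letter k n \<in> V"
  using octant bot_V by (auto simp: letter_def octant_tiling_def)

lemma letter_H: "k < n \<Longrightarrow> H (letter k n) (letter (k + 1) n)"
proof (cases "k < 0")
  case True
  assume "k < n"
  with True show ?thesis using H_bot octant
    by (cases "k = -1") (auto simp: letter_def octant_tiling_def)
next
  case False
  assume "k < n"
  with False have "nat k < nat n" "nat (k + 1) = Suc (nat k)" by auto
  then show ?thesis using octant False by (auto simp: letter_def octant_tiling_def)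
qed

lemma letter_W: "k \<le> n \<Longrightarrow> W (letter k n) (letter k (n + 1))"
proof (cases "k < 0")
  case True
  then show ?thesis using W_bot by (auto simp: letter_def)
next
  case False
  assume "k \<le> n"
  with False have "nat k \<le> nat n" "nat (n + 1) = Suc (nat n)" by auto
  then show ?thesis using octant False by (auto simp: letter_def octant_tiling_def)
qed

lemma letter_top: "top (letter n n)"
  using octant top_bot by (auto simp: letter_def octant_tiling_def)

lemma base_base: "ok (base m) (0, 0) (base (m + 1))"
proof -
  have "N - nat m = Suc (N - nat (m + 1))" if "0 \<le> m" "m < int N"
    using that by linarith
  moreover consider "m < - 1" | "m = - 1" | "0 \<le> m" "m < int N" | "m = int N" | "int N < m"
    by linarith
  ultimately show ?thesis
    by cases (auto simp: base_def intro: ok.intros)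
qed

lemma base_Col: "ok (base m) (0, 1) (Col (letter m m))"
proof (cases "m < 0 \<or> m \<ge> int N")
  case True
  then consider "m < 0" | "m = int N" | "m > int N" by linarith
  then show ?thesis
    using octant by cases (auto simp: base_def letter_def octant_tiling_def
      intro!: Neg_Col Chain_Col_start Run_Col simp del: One_nat_def)
next
  case False
  then have "nat m < N" by linarith
  then have "v (nat m) (nat m) \<in> {ll, lp}"
    using octant unfolding octant_tiling_def by blast
  then have "letter m m \<in> {ll, lp}" using False by (simp add: letter_def)
  moreover have "base m = Chain (Suc (N - nat m - 1))"
    using False by (auto simp: base_def)
  ultimately show ?thesis using Chain_Col_ll Chain_Col_lp by auto
qed

lemma Top_base: "ok (Top (letter m m)) (1, 0) (base (m + 1))"
proof (cases "m + 1 < 0 \<or> m + 1 \<ge> int N")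
  case True
  then consider "m + 1 < 0" | "m + 1 = int N" | "m + 1 > int N" by linarith
  then show ?thesis
    by cases (auto simp: base_def intro: ok.intros simp del: One_nat_def)
next
  case False
  then have "base (m + 1) = Chain (Suc (N - nat (m + 1) - 1))"
    by (auto simp: base_def)
  moreover have "letter m m = bot \<or> letter m m = ll"
    using False octant by (auto simp: letter_def octant_tiling_def)
  ultimately show ?thesis using Top_Chain_bot Top_Chain_ll by auto
qed

lemma octant_colour_colours: "octant_colour (m, x) \<in> colours N"
  by (auto simp: octant_colour_def colours_def base_def zclass_One intro!: letter_V
      split: zclass.splits)

lemma octant_colour_edge:
  assumes "\<And>i. i \<noteq> m \<Longrightarrow> x i = y i"
  shows "ok (octant_colour (m, x)) (x m, y m) (octant_colour (m + 1, y))"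
proof -
  \<comment> \<open>The two words agree on both sides of position \<open>m\<close>, with classes
    \<open>u\<close> and \<open>w\<close>. The digit \<open>x m\<close> belongs to the upper part
    before the crossing, \<open>y m\<close> to the lower part after it, so the check splits over
    \<open>u\<close>, \<open>w\<close> and whether these digits are 0, 1 or larger.\<close>
  define u w where "u = zclass {..<m} x" and "w = zclass {m<..} x"
  have sets: "{m..} = insert m {m<..}" "{..<m + 1} = insert m {..<m}" "{m + 1..} = {m<..}" by auto
  have cong: "zclass {..<m} y = u" "zclass {m<..} y = w"
    unfolding u_def w_def using assms by (auto intro!: zclass_cong)
  have zl: "zclass {m..} x = (case w of
       Zeros \<Rightarrow> if x m = 0 then Zeros else if x m = 1 then One m else Many
     | One k \<Rightarrow> if x m = 0 then One k else Many
     | Many \<Rightarrow> Many)"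
    unfolding sets w_def by (rule zclass_insert) simp
  have zu: "zclass {..<m + 1} y = (case u of
       Zeros \<Rightarrow> if y m = 0 then Zeros else if y m = 1 then One m else Many
     | One k \<Rightarrow> if y m = 0 then One k else Many
     | Many \<Rightarrow> Many)"
    unfolding sets cong(1)[symmetric] by (rule zclass_insert) simp
  have zw: "zclass {m + 1..} y = w" unfolding sets by (rule cong)
  have k: "k < m" if "u = One k" for k using that by (simp add: u_def zclass_One)
  have n: "m < n" if "w = One n" for n using that by (simp add: w_def zclass_One)
  have base: "ok Junk (a, 0) (base m)" if "2 \<le> a" for a m
    using that by (auto simp: base_def intro: ok.intros)
  have base': "ok (base m) (0, b) Junk" if "2 \<le> b" for b m
    using that by (auto simp: base_def intro: ok.intros)
  have W: "ok (Col (letter k (m - 1))) (0, 0) (Col (letter k m))" if "k < m" for k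
    using letter_W[of k "m - 1"] that by (auto intro: Col_Col)
  have H1: "ok (Row (letter m (m + 1))) (0, 0) (Top (letter (m + 1) (m + 1)))"
    using letter_H[of m "m + 1"] letter_top[of "m + 1"] by (auto intro: Row_Top)
  have H2: "ok (Row (letter m n)) (0, 0) (Row (letter (m + 1) n))" if "m < n" for n
    using letter_H[OF that] by (rule Row_Row)
  note intros = ok.intros[unfolded One_nat_def] base base' base_base W H1 H2
    Top_base[unfolded One_nat_def] base_Col[unfolded One_nat_def]
  have ge2: "a = 0 \<or> a = 1 \<or> 2 \<le> a" for a :: nat by linarith
  note oc = octant_colour_def u_def[symmetric] zl zu zw
  show ?thesis
  proof (cases u)
    case u: Zeros
    show ?thesis
    proof (cases w)
      case w: Zeros
      show ?thesis using ge2[of "x m"] ge2[of "y m"]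
        by (elim disjE) (auto simp: oc u w intro: intros)
    next
      case w: (One n)
      show ?thesis using ge2[of "x m"] ge2[of "y m"] n[OF w]
        by (elim disjE) (auto simp: oc u w intro: intros)
    next
      case w: Many
      show ?thesis by (auto simp: oc u w intro: intros)
    qed
  next
    case u: (One k)
    show ?thesis
    proof (cases w)
      case w: Zeros
      show ?thesis using ge2[of "x m"] ge2[of "y m"] k[OF u]
        by (elim disjE) (auto simp: oc u w intro: intros)
    next
      case w: (One n)
      show ?thesis using ge2[of "x m"] ge2[of "y m"] k[OF u] n[OF w]
        by (elim disjE) (auto simp: oc u w intro: intros)
    next
      case w: Many
      show ?thesis by (auto simp: oc u w intro: intros)
    qed
  next
    case u: Many
    show ?thesis by (auto simp: oc u intro: intros)
  qed
qed

lemma tiling_of_octant: "has_seeded_tiling p q (colours N) (rules p q N) (Chain N)"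
  unfolding has_seeded_tiling_def
proof (intro exI[of _ octant_colour] conjI ballI)
  show "octant_colour v \<in> colours N" for v
    using octant_colour_colours by (cases v) simp
  show "octant_colour DL_seed = Chain N"
    by (simp add: octant_colour_def DL_seed_def zclass_def base_def)
next
  fix e assume e: "e \<in> DL_edges p q"
  then obtain m x y where "e = ((m, x), (m + 1, y))" "\<And>i. i \<noteq> m \<Longrightarrow> x i = y i"
      "(m, x) \<in> DL_verts p q" "(m + 1, y) \<in> DL_verts p q"
    by (auto simp: DL_edges_def)
  moreover from this have "x m < p" "y m < q" by (auto simp: DL_verts_def)
  ultimately show "case e of (u, v) \<Rightarrow> (octant_colour u, DL_label (u, v), octant_colour v) \<in> rules p q N"
    using octant_colour_edge[of m x y] octant_colour_colours by (auto simp: rules_def)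
qed

end

theorem has_seeded_tiling_iff_octant:
  assumes "2 \<le> p" "2 \<le> q"
  shows "has_seeded_tiling p q (colours N) (rules p q N) (Chain N) \<longleftrightarrow> (\<exists>v. octant_tiling N v)"
proof
  assume "has_seeded_tiling p q (colours N) (rules p q N) (Chain N)"
  then obtain \<kappa> where "\<kappa> DL_seed = Chain N"
      "\<And>u v. (u, v) \<in> DL_edges p q \<Longrightarrow> (\<kappa> u, DL_label (u, v), \<kappa> v) \<in> rules p q N"
    unfolding has_seeded_tiling_def by blast
  then show "\<exists>v. octant_tiling N v" using octant_of_tiling assms by blast
qed (use tiling_of_octant in blast)

end

section \<open>Runs of counter machines as octant tilings\<close>

datatype 's letter = Blank | Tile "'s option" "'s option" "nat set" "nat set"

text \<open>\<open>RS\<close> contains every register on which a transition may depend. Letters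
  record only these registers, which keeps the alphabet finite.\<close>

locale counter_machine =
  fixes Q :: "'s set" and RS :: "nat set" and up dn :: "'s \<Rightarrow> nat set"
    and nxt :: "'s \<Rightarrow> nat set \<Rightarrow> 's" and init :: 's and halted :: "'s \<Rightarrow> bool"
  assumes finite_Q: "finite Q" and init_Q: "init \<in> Q" and finite_RS: "finite RS" and zero_RS: "0 \<in> RS"
    and nxt_Q: "s \<in> Q \<Longrightarrow> \<not> halted s \<Longrightarrow> nxt s A \<in> Q"
    and nxt_RS: "s \<in> Q \<Longrightarrow> nxt s (A \<inter> RS) = nxt s A"
    and up_dn: "up s \<inter> dn s = {}"
begin

text \<open>The state \<^term>\<open>None\<close> of a letter means that the input is still being loaded into register 0.\<close>

fun load_up :: "'s option \<Rightarrow> nat set" where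
  "load_up None = {0}"
| "load_up (Some s) = up s"

fun load_dn :: "'s option \<Rightarrow> nat set" where
  "load_dn None = {}"
| "load_dn (Some s) = dn s"

text \<open>The moment at which loading ends is left open here and fixed by the diagonal letters. A
  halted state has no successor, so a halting run admits no tiling.\<close>

fun advance :: "'s option \<Rightarrow> nat set \<Rightarrow> 's option \<Rightarrow> bool" where
  "advance None A t \<longleftrightarrow> t = None \<or> t = Some init"
| "advance (Some s) A t \<longleftrightarrow> \<not> halted s \<and> t = Some (nxt s A)"

definition keep :: "'s option \<Rightarrow> nat set \<Rightarrow> nat set \<Rightarrow> bool" where
  "keep s A B \<longleftrightarrow> (\<forall>i. i \<notin> load_up s \<longrightarrow> i \<notin> load_dn s \<longrightarrow> (i \<in> B \<longleftrightarrow> i \<in> A))"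

text \<open>
  The letter \<open>Tile s t A B\<close> at place \<open>k\<close> of row \<open>n\<close> says that the machine passes from state \<open>s\<close> at
  time \<open>n\<close> to state \<open>t\<close>, and that the registers with contents above \<open>k\<close> are those in \<open>A\<close> before
  the step and those in \<open>B\<close> after it.
\<close>

fun hor :: "'s letter \<Rightarrow> 's letter \<Rightarrow> bool" where
  "hor Blank Blank \<longleftrightarrow> True"
| "hor Blank (Tile s t A B) \<longleftrightarrow> advance s A t \<and> RS \<inter> load_up s \<subseteq> B \<and> keep s A B"
| "hor (Tile s t A B) (Tile s' t' A' B') \<longleftrightarrow> s' = s \<and> t' = t \<and> keep s A' B' \<and>
     (\<forall>i\<in>load_up s. i \<in> B' \<longleftrightarrow> i \<in> A) \<and> (\<forall>i\<in>load_dn s. i \<in> B \<longleftrightarrow> i \<in> A')"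
| "hor (Tile s t A B) Blank \<longleftrightarrow> False"

fun ver :: "'s letter \<Rightarrow> 's letter \<Rightarrow> bool" where
  "ver (Tile s t A B) (Tile s' t' A' B') \<longleftrightarrow> s' = t \<and> A' = B"
| "ver Blank Blank \<longleftrightarrow> True"
| "ver _ _ \<longleftrightarrow> False"

text \<open>Before step \<open>n\<close> no register exceeds \<open>n\<close>, so \<open>A\<close>
  is empty at place \<open>n\<close> of row \<open>n\<close>. The condition on decremented registers
  replaces the comparison with the missing right neighbour, where \<open>A\<close> would be empty
  too.\<close>

fun end_ok :: "'s letter \<Rightarrow> bool" where
  "end_ok Blank \<longleftrightarrow> True"
| "end_ok (Tile s t A B) \<longleftrightarrow> A = {} \<and> load_dn s \<inter> B = {}"

fun start_ok :: "'s letter \<Rightarrow> bool" where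
  "start_ok Blank \<longleftrightarrow> False"
| "start_ok (Tile s t A B) \<longleftrightarrow> s = Some init"

definition letters :: "'s letter set" where
  "letters = insert Blank (\<Union>s\<in>insert None (Some ` Q). \<Union>t\<in>insert None (Some ` Q).
     \<Union>A\<in>Pow RS. \<Union>B\<in>Pow RS. {Tile s t A B})"

lemma finite_letters: "finite letters"
  unfolding letters_def by (simp add: finite_Q finite_RS)

lemma Tile_letters:
  "Tile s t A B \<in> letters \<longleftrightarrow>
     s \<in> insert None (Some ` Q) \<and> t \<in> insert None (Some ` Q) \<and> A \<subseteq> RS \<and> B \<subseteq> RS"
  unfolding letters_def by auto

text \<open>At the diagonal place \<open>n\<close> of a loading step, register 0 grows from
  \<open>n\<close> to \<open>n + 1\<close> and so exceeds \<open>n\<close> only afterwards. This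
  gives the sets \<open>{}\<close> and \<open>{0}\<close>, whatever \<open>n\<close> is.\<close>

sublocale octant_system letters Blank hor ver end_ok start_ok
  "Tile None None {} {0}" "Tile None (Some init) {} {0}"
proof
  show "finite letters" by (rule finite_letters)
  show "Blank \<in> letters" by (simp add: letters_def)
  show "ver Blank v \<longleftrightarrow> v = Blank" for v by (cases v) auto
  show "ver v Blank \<Longrightarrow> v = Blank" for v by (cases v) auto
qed (use init_Q zero_RS in \<open>auto simp: Tile_letters\<close>)

section \<open>Runs preceded by the loading of register 0\<close>

abbreviation "run N m \<equiv> (mstep up dn nxt ^^ m) (init, (\<lambda>_. 0)(0 := N))"

text \<open>Time is shifted by \<open>N\<close>: the steps \<open>n < N\<close> raise register 0
  from \<open>n\<close> to \<open>n + 1\<close>, and the machine proper starts at time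
  \<open>N\<close>.\<close>

definition st :: "nat \<Rightarrow> nat \<Rightarrow> 's option" where
  "st N n = (if n < N then None else Some (fst (run N (n - N))))"

definition rg :: "nat \<Rightarrow> nat \<Rightarrow> nat \<Rightarrow> nat" where
  "rg N n = (if n < N then (\<lambda>_. 0)(0 := n) else snd (run N (n - N)))"

lemma rg_Suc: "rg N (Suc n) i = (if i \<in> load_up (st N n) then Suc (rg N n i)
    else if i \<in> load_dn (st N n) then rg N n i - 1 else rg N n i)"
proof (cases "n < N")
  case True
  then have "Suc n < N \<or> Suc n = N" by linarith
  then show ?thesis by (auto simp: rg_def st_def)
next
  case False
  then have "Suc n - N = Suc (n - N)" by linarith
  with False show ?thesis
    by (simp add: rg_def st_def mstep_def split: prod.split)
qed

lemma rg_le: "rg N n i \<le> n"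
proof (induction n)
  case 0
  then show ?case by (simp add: rg_def)
next
  case (Suc n)
  then show ?case by (auto simp: rg_Suc)
qed

lemma st_Suc: "N \<le> n \<Longrightarrow> st N n = Some s \<Longrightarrow> st N (Suc n) = Some (nxt s {i. 0 < rg N n i})"
  by (auto simp: st_def rg_def Suc_diff_le mstep_def split: prod.split)

lemma st_Q:
  assumes "\<And>m. m < n - N \<Longrightarrow> \<not> halted (fst (run N m))"
  shows "st N n \<in> insert None (Some ` Q)"
  using assms
proof (induction n)
  case 0
  then show ?case using init_Q by (simp add: st_def)
next
  case (Suc n)
  consider "Suc n < N" | "Suc n = N" | "N \<le> n" by linarith
  then show ?case
  proof cases
    case 3
    then obtain s where s: "st N n = Some s" by (simp add: st_def)
    have "n - N < Suc n - N" using 3 by simp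
    then have "\<not> halted (fst (run N (n - N)))" by (rule Suc.prems)
    then have "\<not> halted s" using s 3 by (simp add: st_def)
    moreover have "s \<in> Q" using Suc s by (auto simp: less_Suc_eq_le)
    ultimately show ?thesis using nxt_Q st_Suc[OF 3 s] by simp
  qed (use init_Q in \<open>auto simp: st_def\<close>)
qed

definition bits :: "nat \<Rightarrow> nat \<Rightarrow> nat \<Rightarrow> nat set" where
  "bits N k n = {i \<in> RS. k < rg N n i}"

lemma bits_end: "bits N n n = {}"
  using rg_le by (auto simp: bits_def not_less)

lemma nxt_bits: "s \<in> Q \<Longrightarrow> nxt s (bits N 0 n) = nxt s {i. 0 < rg N n i}"
  using nxt_RS[of s "{i. 0 < rg N n i}"] by (simp add: bits_def Collect_conj_eq inf_commute)

section \<open>Equivalence of infinite runs and octant tilings\<close>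

lemma octant_of_run:
  assumes run: "\<And>m. \<not> halted (fst (run N m))"
  shows "octant_tiling N (\<lambda>k n. Tile (st N n) (st N (Suc n)) (bits N k n) (bits N k (Suc n)))"
proof -
  have Q: "st N n \<in> insert None (Some ` Q)" for n
    using st_Q run by blast
  have V: "Tile (st N n) (st N (Suc n)) (bits N k n) (bits N k (Suc n)) \<in> letters" for k n
    unfolding Tile_letters using Q by (auto simp: bits_def)
  have keep: "keep (st N n) (bits N k n) (bits N k (Suc n))" for k n
    by (auto simp: keep_def bits_def rg_Suc)
  have adv: "advance (st N n) (bits N 0 n) (st N (Suc n))" for n
  proof (cases "n < N")
    case True
    then have "Suc n < N \<or> Suc n = N" by linarith
    then show ?thesis by (auto simp: st_def)
  next
    case False
    then obtain s where s: "st N n = Some s" by (simp add: st_def)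
    have "\<not> halted s" using run[of "n - N"] s False by (auto simp: st_def)
    then show ?thesis using False s st_Suc[of N n s] nxt_bits[of s] Q[of n] by auto
  qed
  \<comment> \<open>Thresholds turn a change by one into a shift by one place: \<open>r + 1\<close>
    exceeds \<open>k + 1\<close> iff \<open>r\<close> exceeds \<open>k\<close>, and
    \<open>r - 1\<close> exceeds \<open>k\<close> iff \<open>r\<close> exceeds \<open>k + 1\<close>.
    Hence comparing neighbouring places suffices.\<close>
  have up: "i \<in> load_up (st N n) \<Longrightarrow> i \<in> bits N (Suc k) (Suc n) \<longleftrightarrow> i \<in> bits N k n" for i k n
    by (auto simp: bits_def rg_Suc)
  have up0: "RS \<inter> load_up (st N n) \<subseteq> bits N 0 (Suc n)" for n
    by (auto simp: bits_def rg_Suc)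
  have disj: "load_up s \<inter> load_dn s = {}" for s using up_dn by (cases s) auto
  have dn: "i \<in> load_dn (st N n) \<Longrightarrow> i \<in> bits N k (Suc n) \<longleftrightarrow> i \<in> bits N (Suc k) n" for i k n
    using disj[of "st N n"] by (auto simp: bits_def rg_Suc)
  have dn_end: "load_dn (st N n) \<inter> bits N n (Suc n) = {}" for n
  proof -
    have "i \<notin> bits N (Suc n) n" for i using rg_le[of N n i] by (simp add: bits_def)
    then show ?thesis using dn[of _ n n] by blast
  qed
  have load: "st N n = None" "bits N n (Suc n) = {0}" if "n < N" for n
    using that zero_RS by (auto simp: st_def bits_def rg_Suc) (auto simp: rg_def split: if_splits)
  have init: "st N N = Some init" by (simp add: st_def)
  have Suc_st: "st N (Suc n) \<in> {None, Some init}" if "n < N" for n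
    using that by (auto simp: st_def le_less_Suc_eq)
  show ?thesis
    unfolding octant_tiling_def
  proof (intro conjI allI impI)
    show "Tile (st N n) (st N (Suc n)) (bits N n n) (bits N n (Suc n))
        \<in> {Tile None None {} {0}, Tile None (Some init) {} {0}}" if "n < N" for n
      using load[OF that] Suc_st[OF that] by (auto simp: bits_end)
    show "Tile (st N n) (st N (Suc n)) (bits N n n) (bits N n (Suc n)) = Tile None None {} {0}"
      if "Suc n < N" for n
      using load[of n] load[of "Suc n"] that by (simp add: bits_end)
  qed (use V keep adv up up0 dn dn_end init in \<open>simp_all add: bits_end\<close>)
qed

text \<open>Row by row the tiling is forced to record the run: the sets \<open>A\<close> of a row
  determine its sets \<open>B\<close>, \<open>ver\<close> passes these to the next row, and
  \<open>end_ok\<close> fixes the new last place. As \<open>advance\<close> needs a state that is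
  not halted, the run never halts.\<close>

lemma run_of_octant:
  assumes "octant_tiling N v"
  shows "\<not> halted (fst (run N m))"
proof -
  have V: "v k n \<in> letters" "v k n \<noteq> Blank" "ver (v k n) (v k (Suc n))" if "k \<le> n" for k n
    using assms that unfolding octant_tiling_def by blast+
  have H: "hor (v k n) (v (Suc k) n)" if "k < n" for k n
    using assms that unfolding octant_tiling_def by blast
  have H0: "hor Blank (v 0 n)" "end_ok (v n n)" for n
    using assms unfolding octant_tiling_def by blast+
  have diag: "n < N \<Longrightarrow> v n n \<in> {Tile None None {} {0}, Tile None (Some init) {} {0}}"
    "start_ok (v N N)" for n
    using assms unfolding octant_tiling_def by blast+
  have "\<exists>s t A B. k \<le> n \<longrightarrow> v k n = Tile s t A B" for k n
    using V(2)[of k n] by (cases "v k n") auto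
  then obtain s t A B where v: "\<And>k n. k \<le> n \<Longrightarrow> v k n = Tile (s k n) (t k n) (A k n) (B k n)"
    by metis
  have row: "s k n = s 0 n \<and> t k n = t 0 n" if "k \<le> n" for k n
    using that
  proof (induction k)
    case (Suc k)
    then show ?case using H[of k n] v[of k n] v[of "Suc k" n] by simp
  qed simp
  have adv: "advance (s 0 n) (A 0 n) (t 0 n)" for n
    using H0(1)[of n] v[of 0 n] by simp
  have keep: "keep (s 0 n) (A k n) (B k n)" if "k \<le> n" for k n
  proof (cases k)
    case 0
    then show ?thesis using H0(1)[of n] v[of 0 n] by simp
  next
    case (Suc k')
    then show ?thesis using H[of k' n] v[of k' n] v[of k n] row[of k' n] that by simp
  qed
  have RS: "s k n \<in> insert None (Some ` Q)" "A k n \<subseteq> RS" "B k n \<subseteq> RS" if "k \<le> n" for k n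
    using V(1)[OF that] v[OF that] Tile_letters by auto
  have init_state: "s n n = st N n" if "n \<le> N" for n
    using diag(1)[of n] diag(2) v[of n n] that by (cases "n = N") (auto simp: st_def)
  have "(\<forall>k\<le>n. s k n = st N n \<and> A k n = bits N k n)" for n
  proof (induction n)
    case 0
    then show ?case using init_state[of 0] H0(2)[of 0] v[of 0 0] by (simp add: bits_end)
  next
    case (Suc n)
    then have s: "s 0 n = st N n" and A: "\<And>k. k \<le> n \<Longrightarrow> A k n = bits N k n" by auto
    have B: "B k n = bits N k (Suc n)" if k: "k \<le> n" for k
    proof -
      \<comment> \<open>Incremented registers are compared with the left neighbour, decremented ones
        with the right neighbour, the others with \<open>A\<close> at the same place; the first and
        last places use the rules for \<open>Blank\<close> and \<open>end_ok\<close>.\<close>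
      have "i \<in> B k n \<longleftrightarrow> k < rg N (Suc n) i" if i: "i \<in> RS" for i
      proof -
        consider "i \<in> load_up (st N n)" | "i \<notin> load_up (st N n)" "i \<in> load_dn (st N n)" |
          "i \<notin> load_up (st N n)" "i \<notin> load_dn (st N n)" by blast
        then show ?thesis
        proof cases
          case 1
          show ?thesis
          proof (cases k)
            case 0
            then show ?thesis using 1 i H0(1)[of n] v[of 0 n] s by (auto simp: rg_Suc)
          next
            case (Suc k')
            then have "i \<in> B k n \<longleftrightarrow> i \<in> A k' n"
              using H[of k' n] v[of k' n] v[of k n] row[of k' n] k s 1 by simp
            moreover have "A k' n = bits N k' n" using A[of k'] k Suc by simp
            ultimately show ?thesis using 1 i Suc by (simp add: bits_def rg_Suc)
          qed
        next
          case 2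
          show ?thesis
          proof (cases "k = n")
            case True
            then have "i \<notin> B k n"
              using H0(2)[of n] v[of n n] row[of n n] 2 s by auto
            then show ?thesis using 2 True rg_le[of N n i] by (simp add: rg_Suc)
          next
            case False
            then have "i \<in> B k n \<longleftrightarrow> i \<in> A (Suc k) n"
              using H[of k n] v[of k n] v[of "Suc k" n] row[of k n] k s 2 by simp
            moreover have "A (Suc k) n = bits N (Suc k) n" using A[of "Suc k"] k False by simp
            ultimately show ?thesis using 2 i by (simp add: bits_def rg_Suc less_diff_conv)
          qed
        next
          case 3
          then show ?thesis using keep[OF k] A[OF k] s i by (simp add: keep_def bits_def rg_Suc)
        qed
      qed
      then show ?thesis using RS(3)[OF k] by (auto simp: bits_def)
    qed
    have next_row: "s k (Suc n) = t 0 n" "A k (Suc n) = B k n" if "k \<le> n" for k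
      using V(3)[OF that] v[OF that] v[of k "Suc n"] row[OF that] that by auto
    \<comment> \<open>Up to time \<open>N\<close> the next state is known from the diagonal of the
      next row, afterwards from \<open>advance\<close>.\<close>
    have t: "t 0 n = st N (Suc n)"
    proof (cases "Suc n \<le> N")
      case True
      then show ?thesis
        using init_state[OF True] row[of "Suc n" "Suc n"] next_row(1)[of 0] by simp
    next
      case False
      then obtain s' where s': "st N n = Some s'" by (simp add: st_def)
      have "s' \<in> Q" using RS(1)[of 0 n] s s' by auto
      then show ?thesis
        using adv[of n] s s' A[of 0] st_Suc[of N n s'] False nxt_bits[of s' N n] by simp
    qed
    show ?case
    proof (intro allI impI)
      fix k assume k: "k \<le> Suc n"
      have "A (Suc n) (Suc n) = {}" using H0(2)[of "Suc n"] v[of "Suc n" "Suc n"] by simp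
      then have "A k (Suc n) = bits N k (Suc n)"
        using k next_row(2)[of k] B[of k] by (cases "k = Suc n") (auto simp: bits_end)
      moreover have "s k (Suc n) = st N (Suc n)"
        using row[OF k] next_row(1)[of 0] t by simp
      ultimately show "s k (Suc n) = st N (Suc n) \<and> A k (Suc n) = bits N k (Suc n)" by simp
    qed
  qed
  then have "s 0 (N + m) = Some (fst (run N m))" by (simp add: st_def)
  then show ?thesis using adv[of "N + m"] by simp
qed

theorem tiling_iff_run:
  assumes "2 \<le> p" "2 \<le> q"
  shows "has_seeded_tiling p q (colours N) (rules p q N) (Chain N) \<longleftrightarrow>
    (\<forall>m. \<not> halted (fst (run N m)))"
  using has_seeded_tiling_iff_octant[OF assms] octant_of_run run_of_octant by blast

end

section \<open>Encoding and diagonalisation\<close>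

text \<open>Every vertex is the lower end of an edge, obtained by setting the crossed digit to 0, so
  a rule already places its colour in \<open>C\<close>.\<close>

lemma has_seeded_tiling_iff:
  assumes "0 < q" and R: "R \<subseteq> C \<times> UNIV \<times> C"
  shows "has_seeded_tiling p q C R c0 \<longleftrightarrow>
    (\<exists>\<kappa>. \<kappa> DL_seed = c0 \<and> (\<forall>(u, v)\<in>DL_edges p q. (\<kappa> u, DL_label (u, v), \<kappa> v) \<in> R))"
proof -
  have "\<kappa> w \<in> C" if w: "w \<in> DL_verts p q"
    and \<kappa>: "\<forall>(u, v)\<in>DL_edges p q. (\<kappa> u, DL_label (u, v), \<kappa> v) \<in> R" for \<kappa> :: "vertex \<Rightarrow> 'a" and w
  proof -
    obtain n x where nx: "w = (n, x)" by (cases w)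
    have "finite {i. (x(n := 0)) i \<noteq> 0}"
      by (rule finite_subset[of _ "{i. x i \<noteq> 0}"]) (use w in \<open>auto simp: nx DL_verts_def\<close>)
    then have "((n, x), (n + 1, x(n := 0))) \<in> DL_edges p q"
      using w \<open>0 < q\<close> by (auto simp: nx DL_edges_def DL_verts_def)
    then have "(\<kappa> (n, x), DL_label ((n, x), (n + 1, x(n := 0))), \<kappa> (n + 1, x(n := 0))) \<in> R"
      using \<kappa> by blast
    then show ?thesis using R nx by auto
  qed
  then show ?thesis unfolding has_seeded_tiling_def by blast
qed

definition map_rule :: "('a \<Rightarrow> 'b) \<Rightarrow> 'a rule \<Rightarrow> 'b rule" where
  "map_rule f = (\<lambda>(c, l, d). (f c, l, f d))"

text \<open>Colourings are carried over by \<open>f\<close> and by its inverse on \<open>C\<close>.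
  As \<open>D\<close> may exceed the image of \<open>C\<close>, an initial segment of the numbers,
  whose code is easy to compute, can serve as palette.\<close>

lemma has_seeded_tiling_map_rule:
  assumes "0 < q" "R \<subseteq> C \<times> UNIV \<times> C" "c0 \<in> C" "inj_on f C" "map_rule f ` R \<subseteq> D \<times> UNIV \<times> D"
  shows "has_seeded_tiling p q D (map_rule f ` R) (f c0) \<longleftrightarrow> has_seeded_tiling p q C R c0"
  unfolding has_seeded_tiling_iff[OF assms(1,2)] has_seeded_tiling_iff[OF assms(1,5)]
proof
  assume "\<exists>\<kappa>. \<kappa> DL_seed = c0 \<and> (\<forall>(u, v)\<in>DL_edges p q. (\<kappa> u, DL_label (u, v), \<kappa> v) \<in> R)"
  then obtain \<kappa> where \<kappa>: "\<kappa> DL_seed = c0"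
      "\<And>u v. (u, v) \<in> DL_edges p q \<Longrightarrow> (\<kappa> u, DL_label (u, v), \<kappa> v) \<in> R" by blast
  have "(f (\<kappa> u), DL_label (u, v), f (\<kappa> v)) \<in> map_rule f ` R" if "(u, v) \<in> DL_edges p q" for u v
    using imageI[OF \<kappa>(2)[OF that], of "map_rule f"] by (simp add: map_rule_def)
  with \<kappa>(1) show "\<exists>\<kappa>. \<kappa> DL_seed = f c0 \<and>
      (\<forall>(u, v)\<in>DL_edges p q. (\<kappa> u, DL_label (u, v), \<kappa> v) \<in> map_rule f ` R)"
    by (intro exI[of _ "f \<circ> \<kappa>"]) auto
next
  assume "\<exists>\<kappa>. \<kappa> DL_seed = f c0 \<and>
      (\<forall>(u, v)\<in>DL_edges p q. (\<kappa> u, DL_label (u, v), \<kappa> v) \<in> map_rule f ` R)"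
  then obtain \<kappa> where \<kappa>: "\<kappa> DL_seed = f c0"
      "\<And>u v. (u, v) \<in> DL_edges p q \<Longrightarrow> (\<kappa> u, DL_label (u, v), \<kappa> v) \<in> map_rule f ` R" by blast
  have "(inv_into C f (\<kappa> u), DL_label (u, v), inv_into C f (\<kappa> v)) \<in> R"
    if uv: "(u, v) \<in> DL_edges p q" for u v
  proof -
    obtain c d where cd: "(c, DL_label (u, v), d) \<in> R" "\<kappa> u = f c" "\<kappa> v = f d"
      using \<kappa>(2)[OF uv] by (auto simp: map_rule_def)
    then have "c \<in> C" "d \<in> C" using assms(2) by auto
    with cd assms(4) show ?thesis by simp
  qed
  moreover have "inv_into C f (\<kappa> DL_seed) = c0" using \<kappa>(1) assms(3,4) by simp
  ultimately show "\<exists>\<kappa>. \<kappa> DL_seed = c0 \<and>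
      (\<forall>(u, v)\<in>DL_edges p q. (\<kappa> u, DL_label (u, v), \<kappa> v) \<in> R)"
    by (intro exI[of _ "inv_into C f \<circ> \<kappa>"]) auto
qed

lemma inj_rule_encode: "inj rule_encode"
  by (rule injI) auto

lemma less_set_encode:
  assumes "finite A" "n \<in> A"
  shows "n < set_encode A"
proof -
  have "2 ^ n \<le> (\<Sum>i\<in>A. 2 ^ i :: nat)"
    using assms by (intro member_le_sum) auto
  moreover have "n < 2 ^ n" by (rule less_exp)
  ultimately show ?thesis unfolding set_encode_def by linarith
qed

lemma rule_encode_bounds: "a \<le> rule_encode (a, l, b)" "b \<le> rule_encode (a, l, b)"
proof -
  obtain i j where l: "l = (i, j)" by (cases l)
  have "b \<le> prod_encode (prod_encode (i, j), b)" by (rule le_prod_encode_2)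
  also have "\<dots> \<le> rule_encode (a, l, b)" by (simp add: l le_prod_encode_2)
  finally show "b \<le> rule_encode (a, l, b)" .
qed (cases l, simp add: le_prod_encode_1)

text \<open>
  The colour \<^term>\<open>Chain j\<close> is encoded as \<open>2 * j + 1\<close>, the other colours as even numbers; those
  that occur in a rule with \<^term>\<open>Chain (Suc j)\<close> have codes that do not depend on the machine.
\<close>

definition chain_code :: "nat \<Rightarrow> nat \<Rightarrow> nat \<Rightarrow> nat" where
  "chain_code p q j =
     2 ^ rule_encode (2 * j + 3, (0, 0), 2 * j + 1) + 2 ^ rule_encode (2, (0, 0), 2 * j + 3) +
     2 ^ rule_encode (2 * j + 3, (0, 1), 8) + 2 ^ rule_encode (2 * j + 3, (0, 1), 10) +
     2 ^ rule_encode (4, (1, 0), 2 * j + 3) + 2 ^ rule_encode (6, (1, 0), 2 * j + 3) +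
     (\<Sum>b\<in>{2..<q}. 2 ^ rule_encode (2 * j + 3, (0, b), 0)) +
     (\<Sum>a\<in>{2..<p}. 2 ^ rule_encode (0, (a, 0), 2 * j + 3))"

lemma recursive_fn_chain_code: "recursive_fn 1 (\<lambda>xs. chain_code p q (xs ! 0))"
proof -
  have x: "recursive_fn 1 (\<lambda>xs. xs ! 0)" by (rule recursive_fn_proj) simp
  have lin: "recursive_fn 1 (\<lambda>xs. 2 * (xs ! 0) + c)" for c
    unfolding mult_2 by (intro recursive_fn_add x recursive_fn_const)
  have c: "recursive_fn 1 (\<lambda>_. c)" for c by (rule recursive_fn_const)
  have "recursive_fn 1 (\<lambda>xs. 2 ^ rule_encode (2 * (xs ! 0) + 3, (a, b), d))"
    "recursive_fn 1 (\<lambda>xs. 2 ^ rule_encode (d, (a, b), 2 * (xs ! 0) + 3))"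
    "recursive_fn 1 (\<lambda>xs. 2 ^ rule_encode (2 * (xs ! 0) + 3, (a, b), 2 * (xs ! 0) + 1))" for a b d
    unfolding rule_encode.simps
    by (rule recursive_fn_power2 recursive_fn_prod_encode c lin)+
  note * = this
  show ?thesis
    unfolding chain_code_def
    by (intro recursive_fn_add recursive_fn_sum_set finite_atLeastLessThan *)
qed

section \<open>The code of the rules as a function of the countdown length\<close>

context octant_system
begin

inductive_cases ok_ChainE: "ok (Chain j) l c"
inductive_cases ok_into_ChainE: "ok c l (Chain j)"

definition chain_rules :: "nat \<Rightarrow> nat \<Rightarrow> nat \<Rightarrow> 'v colour rule set" where
  "chain_rules p q j =
     {(Chain (Suc j), (0, 0), Chain j), (Neg, (0, 0), Chain (Suc j)),
      (Chain (Suc j), (0, 1), Col ll), (Chain (Suc j), (0, 1), Col lp),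
      (Top bot, (1, 0), Chain (Suc j)), (Top ll, (1, 0), Chain (Suc j))} \<union>
     (\<lambda>b. (Chain (Suc j), (0, b), Junk)) ` {2..<q} \<union>
     (\<lambda>a. (Junk, (a, 0), Chain (Suc j))) ` {2..<p}"

text \<open>The palette gains one colour, \<open>Chain (Suc N)\<close>, and
  \<open>chain_rules\<close> lists the rules at it. A rule into it from
  \<open>Chain (Suc (Suc N))\<close> is excluded because that is not a colour.\<close>

lemma rules_Suc:
  assumes "2 \<le> p" "2 \<le> q"
  shows "rules p q (Suc N) = rules p q N \<union> chain_rules p q N"
proof -
  have colours: "colours (Suc N) = insert (Chain (Suc N)) (colours N)"
    by (auto simp: colours_def atMost_Suc)
  have old: "Chain (Suc N) \<notin> colours N" "Chain (Suc (Suc N)) \<notin> colours (Suc N)"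
    by (auto simp: colours_def)
  have mem: "Chain N \<in> colours N" "Neg \<in> colours N" "Junk \<in> colours N" "Col ll \<in> colours N"
    "Col lp \<in> colours N" "Top bot \<in> colours N" "Top ll \<in> colours N"
    using bot_V ll_V lp_V by (auto simp: colours_def)
  show ?thesis
  proof (intro equalityI subsetI)
    fix r assume "r \<in> rules p q (Suc N)"
    then obtain c a b d where r: "r = (c, (a, b), d)" "c \<in> colours (Suc N)" "d \<in> colours (Suc N)"
        "a < p" "b < q" "ok c (a, b) d"
      by (auto simp: rules_def)
    consider "c = Chain (Suc N)" | "d = Chain (Suc N)" | "c \<in> colours N" "d \<in> colours N"
      using r(2,3) colours by blast
    then show "r \<in> rules p q N \<union> chain_rules p q N"
    proof cases
      case 1
      then show ?thesis using r(1,4,5) r(6)[unfolded 1]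
        by (auto simp: chain_rules_def elim!: ok_ChainE)
    next
      case 2
      then show ?thesis using r(1,2,4,5) r(6)[unfolded 2] old(2)
        by (auto simp: chain_rules_def elim!: ok_into_ChainE)
    next
      case 3
      then show ?thesis using r by (auto simp: rules_def)
    qed
  next
    fix r assume "r \<in> rules p q N \<union> chain_rules p q N"
    then show "r \<in> rules p q (Suc N)"
    proof
      assume "r \<in> rules p q N"
      then show ?thesis by (auto simp: rules_def colours)
    next
      assume "r \<in> chain_rules p q N"
      then show ?thesis unfolding chain_rules_def rules_def using mem colours assms
        by (auto intro: ok.intros[unfolded One_nat_def])
    qed
  qed
qed

lemma chain_rules_disjoint: "rules p q N \<inter> chain_rules p q N = {}"
  by (auto simp: chain_rules_def rules_def colours_def)

definition machine_encoding :: "('v colour \<Rightarrow> nat) \<Rightarrow> bool" where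
  "machine_encoding enc \<longleftrightarrow> (\<forall>N. inj_on enc (colours N)) \<and> (\<forall>j. enc (Chain j) = 2 * j + 1) \<and>
     enc Junk = 0 \<and> enc Neg = 2 \<and> enc (Top bot) = 4 \<and> enc (Top ll) = 6 \<and> enc (Col ll) = 8 \<and>
     enc (Col lp) = 10"

lemma ex_machine_encoding: "\<exists>enc. machine_encoding enc"
proof -
  obtain g :: "'v colour \<Rightarrow> nat" where g: "inj_on g (colours 0)"
    using finite_imp_inj_to_nat_seg[OF finite_colours] by blast
  \<comment> \<open>The six colours of prescribed code get the values 0 to 5, the offset 6 keeps the
    rest apart from them, and doubling leaves the odd numbers to \<open>Chain\<close>.\<close>
  define h where "h c = (if c = Junk then 0 else if c = Neg then 1 else if c = Top bot then 2
    else if c = Top ll then 3 else if c = Col ll then 4 else if c = Col lp then 5 else 6 + g c)" for c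
  have h: "c = d" if "h c = h d" "c \<in> colours 0" "d \<in> colours 0" for c d
    using that inj_onD[OF g, of c d] by (auto simp: h_def split: if_splits)
  define enc where "enc c = (case c of Chain j \<Rightarrow> 2 * j + 1 | _ \<Rightarrow> 2 * h c)" for c
  have cases: "(\<exists>j. c = Chain j \<and> enc c = 2 * j + 1) \<or> (c \<in> colours 0 \<and> enc c = 2 * h c)"
    if "c \<in> colours N" for c N
    using that by (auto simp: colours_def enc_def)
  have "c = d" if "c \<in> colours N" "d \<in> colours N" "enc c = enc d" for c d N
    using cases[OF that(1)] cases[OF that(2)] that(3) h[of c d] by (elim disjE exE conjE) (simp_all, presburger+)
  then have "inj_on enc (colours N)" for N by (auto intro: inj_onI)
  then have "machine_encoding enc"
    using bot_ll bot_lp ll_lp by (auto simp: machine_encoding_def enc_def h_def)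
  then show ?thesis by blast
qed

context
  fixes enc :: "'v colour \<Rightarrow> nat" and p q :: nat
  assumes enc: "machine_encoding enc" and pq: "2 \<le> p" "2 \<le> q"
begin

definition rules_code :: "nat \<Rightarrow> nat" where
  "rules_code N = set_encode (rule_encode ` map_rule enc ` rules p q N)"

lemma rules_colours: "rules p q N \<subseteq> colours N \<times> UNIV \<times> colours N"
  by (auto simp: rules_def)

lemma rules_code_sum: "rules_code N = (\<Sum>r\<in>rules p q N. 2 ^ rule_encode (map_rule enc r))"
proof -
  have inj: "inj_on enc (colours N)" using enc by (simp add: machine_encoding_def)
  have "inj_on (map_rule enc) (rules p q N)"
  proof (rule inj_onI)
    fix r r' assume "r \<in> rules p q N" "r' \<in> rules p q N" "map_rule enc r = map_rule enc r'"
    then show "r = r'"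
      using rules_colours inj_onD[OF inj] by (fastforce simp: map_rule_def split: prod.splits)
  qed
  then have "inj_on (rule_encode \<circ> map_rule enc) (rules p q N)"
    using inj_rule_encode by (auto intro: comp_inj_on inj_on_subset)
  then show ?thesis
    unfolding rules_code_def set_encode_def image_image
    using sum.reindex[of "rule_encode \<circ> map_rule enc" "rules p q N" "(^) 2"] by (simp add: o_def)
qed

text \<open>A set code is a sum of powers of 2, so a disjoint set of new rules contributes its own
  sum; with the prescribed colour codes this is \<open>chain_code\<close>, which does not mention
  the machine.\<close>

lemma rules_code_Suc: "rules_code (Suc N) = rules_code N + chain_code p q N"
proof -
  let ?e = "\<lambda>r. 2 ^ rule_encode (map_rule enc r) :: nat"
  have fin: "finite (chain_rules p q N)" by (simp add: chain_rules_def)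
  have "(\<Sum>r\<in>chain_rules p q N. ?e r) = chain_code p q N"
  proof -
    let ?A = "{(Chain (Suc N), (0, 0), Chain N), (Neg, (0, 0), Chain (Suc N)),
      (Chain (Suc N), (0, 1), Col ll), (Chain (Suc N), (0, 1), Col lp),
      (Top bot, (1, 0), Chain (Suc N)), (Top ll, (1, 0), Chain (Suc N))}"
    let ?B = "(\<lambda>b. (Chain (Suc N), (0, b), Junk)) ` {2..<q}"
    let ?C = "(\<lambda>a. (Junk, (a, 0), Chain (Suc N))) ` {2..<p}"
    have e: "enc (Chain N) = 2 * N + 1" "enc (Chain (Suc N)) = 2 * N + 3" "enc Junk = 0" "enc Neg = 2"
      "enc (Top bot) = 4" "enc (Top ll) = 6" "enc (Col ll) = 8" "enc (Col lp) = 10"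
      using enc by (simp_all add: machine_encoding_def)
    have "(\<Sum>r\<in>chain_rules p q N. ?e r) = sum ?e (?A \<union> ?B) + sum ?e ?C"
      unfolding chain_rules_def by (rule sum.union_disjoint) auto
    also have "sum ?e (?A \<union> ?B) = sum ?e ?A + sum ?e ?B"
      by (rule sum.union_disjoint) auto
    also have "sum ?e ?B = (\<Sum>b\<in>{2..<q}. 2 ^ rule_encode (2 * N + 3, (0, b), 0))"
      by (subst sum.reindex) (simp_all add: inj_on_def map_rule_def e del: rule_encode.simps)
    also have "sum ?e ?C = (\<Sum>a\<in>{2..<p}. 2 ^ rule_encode (0, (a, 0), 2 * N + 3))"
      by (subst sum.reindex) (simp_all add: inj_on_def map_rule_def e del: rule_encode.simps)
    also have "sum ?e ?A =
     2 ^ rule_encode (2 * N + 3, (0, 0), 2 * N + 1) + 2 ^ rule_encode (2, (0, 0), 2 * N + 3) +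
     2 ^ rule_encode (2 * N + 3, (0, 1), 8) + 2 ^ rule_encode (2 * N + 3, (0, 1), 10) +
     2 ^ rule_encode (4, (1, 0), 2 * N + 3) + 2 ^ rule_encode (6, (1, 0), 2 * N + 3)"
      using bot_ll ll_lp by (simp add: map_rule_def e del: rule_encode.simps)
    finally show ?thesis unfolding chain_code_def .
  qed
  then show ?thesis
    unfolding rules_code_sum rules_Suc[OF pq]
    by (subst sum.union_disjoint[OF finite_rules fin chain_rules_disjoint]) simp
qed

text \<open>The machine enters only through the single number \<open>rules_code 0\<close>.\<close>

lemma rules_code_eq: "rules_code N = rules_code 0 + (\<Sum>j<N. chain_code p q j)"
  by (induction N) (simp_all add: rules_code_Suc)

text \<open>Colour codes are bounded by rule codes, and these by the code of a set containing them,
  which settles length 0. A longer countdown brings in only the codes \<open>2 * N + 1\<close>,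
  \<open>2 * N + 3\<close> and prescribed ones below 12.\<close>

lemma rules_bound:
  "(c, l, d) \<in> rules p q N \<Longrightarrow> enc c < rules_code 0 + 2 * N + 12 \<and> enc d < rules_code 0 + 2 * N + 12"
proof (induction N)
  case 0
  then have "rule_encode (enc c, l, enc d) \<in> rule_encode ` map_rule enc ` rules p q 0"
    by (force simp: map_rule_def)
  then have "rule_encode (enc c, l, enc d) < rules_code 0"
    unfolding rules_code_def using finite_rules by (intro less_set_encode) auto
  then show ?case using rule_encode_bounds(1)[of "enc c" l "enc d"] rule_encode_bounds(2)[of "enc d" "enc c" l]
    by linarith
next
  case (Suc N)
  then consider "(c, l, d) \<in> rules p q N" | "(c, l, d) \<in> chain_rules p q N"
    using rules_Suc[OF pq] by blast
  then show ?case
  proof cases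
    case 1
    then show ?thesis using Suc.IH by simp
  next
    case 2
    then show ?thesis using enc by (auto simp: chain_rules_def machine_encoding_def)
  qed
qed

text \<open>Letting the countdown start at \<open>rules_code 0\<close> turns the bound on the colour
  codes into \<open>3 * N + 12\<close>, so that the whole encoded instance can be computed from
  \<open>N\<close>.\<close>

lemma encoded_instance:
  assumes N: "N = rules_code 0"
  shows "tiling_instance p q {..<3 * N + 12} (map_rule enc ` rules p q N) (2 * N + 1)"
    and "has_seeded_tiling p q {..<3 * N + 12} (map_rule enc ` rules p q N) (2 * N + 1) \<longleftrightarrow>
      has_seeded_tiling p q (colours N) (rules p q N) (Chain N)"
proof -
  have sub: "map_rule enc ` rules p q N \<subseteq> {..<3 * N + 12} \<times> ({0..<p} \<times> {0..<q}) \<times> {..<3 * N + 12}"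
  proof
    fix r assume "r \<in> map_rule enc ` rules p q N"
    then obtain c l d where "r = (enc c, l, enc d)" "(c, l, d) \<in> rules p q N"
      by (auto simp: map_rule_def)
    then show "r \<in> {..<3 * N + 12} \<times> ({0..<p} \<times> {0..<q}) \<times> {..<3 * N + 12}"
      using rules_bound[of c l d N] N by (auto simp: rules_def)
  qed
  then show "tiling_instance p q {..<3 * N + 12} (map_rule enc ` rules p q N) (2 * N + 1)"
    by (auto simp: tiling_instance_def)
  have "has_seeded_tiling p q {..<3 * N + 12} (map_rule enc ` rules p q N) (enc (Chain N)) \<longleftrightarrow>
      has_seeded_tiling p q (colours N) (rules p q N) (Chain N)"
  proof (rule has_seeded_tiling_map_rule[OF _ rules_colours])
    show "inj_on enc (colours N)" using enc by (simp add: machine_encoding_def)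
    show "Chain N \<in> colours N" by (simp add: colours_def)
    show "map_rule enc ` rules p q N \<subseteq> {..<3 * N + 12} \<times> UNIV \<times> {..<3 * N + 12}"
      by (rule order.trans[OF sub]) auto
  qed (use pq in simp)
  then show "has_seeded_tiling p q {..<3 * N + 12} (map_rule enc ` rules p q N) (2 * N + 1) \<longleftrightarrow>
      has_seeded_tiling p q (colours N) (rules p q N) (Chain N)"
    using enc by (simp add: machine_encoding_def)
qed

end

end

section \<open>While programs as counter machines, and halting on output 1\<close>

definition test_regs :: "com list \<Rightarrow> nat set" where
  "test_regs K = (case K of While r c # L \<Rightarrow> {r} | _ \<Rightarrow> {})"

lemma next_cont_cong: "A \<inter> test_regs K = B \<inter> test_regs K \<Longrightarrow> next_cont K A = next_cont K B"
  by (cases "(K, A)" rule: next_cont.cases) (auto simp: test_regs_def)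

definition registers :: "com \<Rightarrow> nat set" where
  "registers c = insert 0 (\<Union>K\<in>conts c []. test_regs K)"

lemma counter_machine_conts:
  "counter_machine (conts c []) (registers c) inc_regs dec_regs next_cont [c] (\<lambda>K. K = [])"
proof
  show "finite (registers c)"
    by (auto simp: registers_def test_regs_def finite_conts split: list.split com.split)
  show "next_cont K (A \<inter> registers c) = next_cont K A" if "K \<in> conts c []" for K A
    by (rule next_cont_cong) (use that in \<open>auto simp: registers_def\<close>)
  show "next_cont K A \<in> conts c []" if "K \<in> conts c []" "K \<noteq> []" for K A
    using conts_closed[OF that(1)] that(2) by blast
  show "inc_regs K \<inter> dec_regs K = {}" for K
    by (cases K rule: inc_regs.cases) auto
qed (auto simp: finite_conts conts_start registers_def)

lemma cstep_halted: "fst ((cstep ^^ m) x) = [] \<Longrightarrow> fst ((cstep ^^ (k + m)) x) = []"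
proof (induction k)
  case (Suc k)
  then have "(cstep ^^ (k + m)) x = ([], snd ((cstep ^^ (k + m)) x))"
    by (metis prod.collapse)
  then show ?case by (simp del: funpow.simps add: funpow.simps(2)) (metis cstep_simps(1) fst_conv)
qed simp

text \<open>Register \<open>r\<close> only grows, so its test never fails and the control alternates
  between two nonempty continuations.\<close>

lemma cstep_loop:
  assumes "0 < s r"
  shows "fst ((cstep ^^ m) ([While r (Inc r)], s)) \<noteq> []"
proof -
  have "\<exists>t. 0 < t r \<and> ((cstep ^^ m) ([While r (Inc r)], s) = ([While r (Inc r)], t) \<or>
      (cstep ^^ m) ([While r (Inc r)], s) = ([Inc r, While r (Inc r)], t))"
  proof (induction m)
    case 0
    then show ?case using assms by auto
  next
    case (Suc m)
    then obtain t where "0 < t r" "(cstep ^^ m) ([While r (Inc r)], s) = ([While r (Inc r)], t) \<or>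
      (cstep ^^ m) ([While r (Inc r)], s) = ([Inc r, While r (Inc r)], t)" by blast
    then show ?case
      by (elim disjE) (auto intro: exI[of _ t] exI[of _ "t(r := Suc (t r))"])
  qed
  then show ?thesis by auto
qed

text \<open>Leaves \<open>1 - y\<close> in register 2, where \<open>y\<close> is the output of \<open>f\<close>, and loops unless it is 0.\<close>

definition halts_on_1 :: "recf \<Rightarrow> com" where
  "halts_on_1 f = Seq (Seq (compile f [0] 1 2) (Seq (Inc 2) (While 1 (Seq (Dec 1) (Dec 2)))))
     (While 2 (Inc 2))"

lemma halts_on_1_iff:
  assumes f: "computes f [N] y" and y: "y \<le> 1"
  shows "(\<forall>m. fst ((cstep ^^ m) ([halts_on_1 f], (\<lambda>_. 0)(0 := N))) \<noteq> []) \<longleftrightarrow> y = 0"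
proof -
  let ?s = "(\<lambda>_. 0)(0 := N)" and ?W = "While 2 (Inc 2)"
  let ?A = "Seq (compile f [0] 1 2) (Seq (Inc 2) (While 1 (Seq (Dec 1) (Dec 2))))"
  have 1: "exec (compile f [0] 1 2) ?s (?s(1 := y))"
    by (rule implementsD[OF implements_compile f]) auto
  have 2: "exec (Inc 2) (?s(1 := y)) (?s(1 := y, 2 := 1))"
    by (rule exec_eq[OF exec_Inc]) simp
  have 3: "exec (While 1 (Seq (Dec 1) (Dec 2))) (?s(1 := y, 2 := 1)) (?s(2 := 1 - y))"
    by (rule exec_While[where n = y and \<sigma> = "\<lambda>j. ?s(1 := y - j, 2 := 1 - j)"])
       (auto intro!: exec_Seq[OF exec_Dec exec_eq[OF exec_Dec]] simp: fun_eq_iff)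
  have A: "exec ?A ?s (?s(2 := 1 - y))"
    using 1 2 3 by (blast intro: exec_Seq)
  show ?thesis
  proof (cases "y = 0")
    case True
    obtain n where "(cstep ^^ n) ([?A, ?W], ?s) = ([?W], ?s(2 := 1))"
      using A True unfolding exec_def by auto
    then have n: "(cstep ^^ (n + 1)) ([halts_on_1 f], ?s) = ([?W], ?s(2 := 1))"
      by (simp only: funpow_add) (simp add: halts_on_1_def)
    have "fst ((cstep ^^ m) ([halts_on_1 f], ?s)) \<noteq> []" for m
    proof
      assume "fst ((cstep ^^ m) ([halts_on_1 f], ?s)) = []"
      \<comment> \<open>A halted run stays halted, so \<open>m\<close> may be replaced by a time
        inside the loop, which is reached after \<open>n + 1\<close> steps.\<close>
      then have "fst ((cstep ^^ (n + 1 + m)) ([halts_on_1 f], ?s)) = []"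
        by (rule cstep_halted)
      also have "n + 1 + m = m + (n + 1)" by simp
      also have "(cstep ^^ (m + (n + 1))) ([halts_on_1 f], ?s) = (cstep ^^ m) ([?W], ?s(2 := 1))"
        by (subst funpow_add) (simp only: o_apply n)
      finally have "fst ((cstep ^^ m) ([?W], ?s(2 := 1))) = []" .
      then show False using cstep_loop[of "?s(2 := 1)" 2 m] by simp
    qed
    with True show ?thesis by simp
  next
    case False
    with y have "y = 1" by simp
    then have "exec ?A ?s (?s(2 := 0))" using A by simp
    moreover have "exec ?W (?s(2 := 0)) (?s(2 := 0))" by (rule exec_While_0) simp
    ultimately have "exec (halts_on_1 f) ?s (?s(2 := 0))"
      unfolding halts_on_1_def by (rule exec_Seq)
    then obtain n where "(cstep ^^ n) ([halts_on_1 f], ?s) = ([], ?s(2 := 0))"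
      unfolding exec_def by blast
    then have "fst ((cstep ^^ n) ([halts_on_1 f], ?s)) = []" by simp
    with False show ?thesis by blast
  qed
qed

section \<open>Diagonalisation against a decision procedure\<close>

theorem theorem7p1:
  fixes p q :: nat
  assumes "p \<ge> 2" and "q \<ge> 2"
  shows "\<not> (\<exists>f. decides_seeded_tiling f p q)"
proof
  assume "\<exists>f. decides_seeded_tiling f p q"
  then obtain f where f: "decides_seeded_tiling f p q" ..
  have x: "recursive_fn 1 (\<lambda>xs. xs ! 0)" by (rule recursive_fn_proj) simp
  have eq: "(\<lambda>xs :: nat list. 3 * (xs ! 0) + 12) = (\<lambda>xs. xs ! 0 + xs ! 0 + xs ! 0 + 12)"
    "(\<lambda>xs :: nat list. 2 * (xs ! 0) + 1) = (\<lambda>xs. xs ! 0 + xs ! 0 + 1)" by auto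
  have lin: "recursive_fn 1 (\<lambda>xs. 3 * (xs ! 0) + 12)" "recursive_fn 1 (\<lambda>xs. 2 * (xs ! 0) + 1)"
    unfolding eq by (intro recursive_fn_add recursive_fn_const x)+
  \<comment> \<open>The codes of the palette and of the rules are computed from the input, which is
    read as \<open>rules_code 0\<close>.\<close>
  have C: "recursive_fn 1 (\<lambda>xs. \<Sum>j<3 * (xs ! 0) + 12. 2 ^ j)"
    by (rule recursive_fn_sum[OF recursive_fn_power2[OF x] lin(1)])
  have R: "recursive_fn 1 (\<lambda>xs. xs ! 0 + (\<Sum>j<xs ! 0. chain_code p q j))"
    by (rule recursive_fn_add[OF x recursive_fn_sum[OF recursive_fn_chain_code x]])
  obtain s1 s2 s3 where s: "\<And>xs. length xs = 1 \<Longrightarrow> computes s1 xs (\<Sum>j<3 * (xs ! 0) + 12. 2 ^ j)"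
      "\<And>xs. length xs = 1 \<Longrightarrow> computes s2 xs (xs ! 0 + (\<Sum>j<xs ! 0. chain_code p q j))"
      "\<And>xs. length xs = 1 \<Longrightarrow> computes s3 xs (2 * (xs ! 0) + 1)"
    using C R lin(2) unfolding recursive_fn_def by blast
  \<comment> \<open>\<open>?F\<close> depends only on \<open>f\<close>, \<open>p\<close> and
    \<open>q\<close>, so the program is fixed before the code of its rules is formed and the
    self-reference is not circular.\<close>
  let ?F = "Comp f [s1, s2, s3]"
  let ?P = "halts_on_1 ?F"
  interpret M: counter_machine "conts ?P []" "registers ?P" inc_regs dec_regs next_cont "[?P]" "\<lambda>K. K = []"
    by (rule counter_machine_conts)
  obtain enc where enc: "M.machine_encoding enc" using M.ex_machine_encoding by blast
  define N where "N = M.rules_code enc p q 0"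
  let ?C = "{..<3 * N + 12}" and ?R = "map_rule enc ` M.rules p q N"
  define y :: nat where "y = (if has_seeded_tiling p q ?C ?R (2 * N + 1) then 1 else 0)"
  have "computes f [set_encode ?C, set_encode (rule_encode ` ?R), 2 * N + 1] y"
    using f M.encoded_instance(1)[OF enc assms N_def]
    unfolding decides_seeded_tiling_def y_def by blast
  moreover have "set_encode ?C = (\<Sum>j<3 * N + 12. 2 ^ j)" by (simp add: set_encode_def)
  moreover have "set_encode (rule_encode ` ?R) = N + (\<Sum>j<N. chain_code p q j)"
    using M.rules_code_eq[OF enc assms, of N] M.rules_code_def[OF enc assms] N_def by simp
  ultimately have "computes ?F [N] y"
    using s[of "[N]"] by (intro computes.Comp[where ys = "[_, _, _]"]) auto
  then have "(\<forall>m. fst ((cstep ^^ m) ([?P], (\<lambda>_. 0)(0 := N))) \<noteq> []) \<longleftrightarrow> y = 0"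
    by (rule halts_on_1_iff) (simp add: y_def)
  \<comment> \<open>The instance has a tiling iff the machine runs forever on \<open>N\<close>; by
    the preceding equivalence this holds iff \<open>y = 0\<close>, which means that there is no
    tiling.\<close>
  moreover have "has_seeded_tiling p q ?C ?R (2 * N + 1) \<longleftrightarrow>
      (\<forall>m. fst ((cstep ^^ m) ([?P], (\<lambda>_. 0)(0 := N))) \<noteq> [])"
    unfolding cstep_def M.encoded_instance(2)[OF enc assms N_def] M.tiling_iff_run[OF assms] ..
  ultimately show False by (auto simp: y_def split: if_splits)
qed

end
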